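(* Let $A$ be a commutative (unital) C*-algebra and let $X:=X_1\times\cdots\times X_n$ be the Cartesian product of $n$ finite pair groupoids $X_k=\{1,\dots,N_k\}\times\{1,\dots,N_k\}$. The hyper-C*-algebra $\mathbb{M}_X(A)$ of $A$-valued hypermatrices indexed by $X$ is the convolution hyper-C*-algebra of the fully involutive full-depth $n$-category $X$. That is, identifying a hypermatrix $[x^{i_1\dots i_n}_{j_1\dots j_n}]$ with the section $\sigma:X\to A$, $\sigma_{((i_1,j_1),\dots,(i_n,j_n))}=x^{i_1\dots i_n}_{j_1\dots j_n}$, the $2^n$ pairs of product and involution of hypermatrices are exactly the $2^n$ pairs of convolution product and involution of the sections of the constant bundle $X\times A$ over $X$ induced by the $2^n$ compositions and involutions of $X$.
   Context: The pair groupoid $X_k$ has composition $(i,j)\circ(j,l)=(i,l)$ and involution (inverse) $(i,j)^*=(j,i)$. Full-depth structure on $X=X_1\times\cdots\times X_n$: for each $\beta\subset\{1,\dots,n\}$, $(x_1,\dots,x_n)$ and $(y_1,\dots,y_n)$ are $\circ_\beta$-composable iff $x_p=y_p$ for all $p\in\beta$ and $(x_p,y_p)$ are composable in $X_p$ for all $p\notin\beta$; then $x\circ_\beta y=(t_1,\dots,t_n)$ with $t_p=x_p=y_p$ for $p\in\beta$ and $t_p=x_p\circ y_p$ for $p\notin\beta$. The involution $*_\beta$ of $X$ paired with $\circ_\beta$ inverts the components $x_p$ with $p\notin\beta$ and fixes those with $p\in\beta$. Convolution operations on sections $\sigma,\rho:X\to A$: $(\sigma\,\hat\circ_\beta\,\rho)_z=\sum_{x\circ_\beta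 y=z}\sigma_x\rho_y$ and $(\sigma^{\hat *_\beta})_z=(\sigma_{z^{*_\beta}})^*$. Operations on $A$-valued hypermatrices $[x^{i_1\dots i_n}_{j_1\dots j_n}]$ ($1\le i_k,j_k\le N_k$, entries in $A$): for $\gamma\subset\{1,\dots,n\}$, the product $\bullet_\gamma$ is matrix multiplication at the levels $k\in\gamma$ and entrywise (Schur) product at the levels $k\notin\gamma$, i.e. $$(x\bullet_\gamma y)^{i_1\dots i_n}_{j_1\dots j_n}=\sum_{(o_k)_{k\in\gamma}}x^{i_1\dots i_n}_{j'_1\dots j'_n}\,y^{i'_1\dots i'_n}_{j_1\dots j_n},$$ with $j'_k=i'_k=o_k$ for $k\in\gamma$ and $j'_k=j_k$, $i'_k=i_k$ for $k\notin\gamma$; the involution $\star_\gamma$ applies the involution of $A$ to all entries and exchanges $i_k$ with $j_k$ for $k\in\gamma$. (In the identification, $\gamma$ corresponds to $\beta=\{1,\dots,n\}\setminus\gamma$.) A hyper-C*-algebra is a complete topological complex vector space equipped with a finite family of pairs of multiplication/involution, each inducing on it a C*-algebra structure via a (necessarily unique) C*-norm compatible with the given topology. *)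

theory Defs
  imports "HOL-Analysis.Analysis"
begin

section \<open>Commutative unital C*-algebras\<close>

text \<open>
  The zero algebra is admitted; \<^class>\<open>comm_ring_1\<close> and
  \<^class>\<open>real_normed_algebra_1\<close>, which impose \<open>0 \<noteq> 1\<close>, are therefore not used.
\<close>

class comm_unital_cstar_algebra = real_normed_algebra + banach + comm_ring + comm_monoid_mult +
  fixes scaleC :: "complex \<Rightarrow> 'a \<Rightarrow> 'a"
    and star :: "'a \<Rightarrow> 'a"
  assumes scaleC_of_real: "scaleC (complex_of_real r) x = scaleR r x"
    and scaleC_add_left: "scaleC (c + d) x = scaleC c x + scaleC d x"
    and scaleC_add_right: "scaleC c (x + y) = scaleC c x + scaleC c y"
    and scaleC_scaleC: "scaleC c (scaleC d x) = scaleC (c * d) x"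
    and mult_scaleC_left: "scaleC c x * y = scaleC c (x * y)"
    and norm_scaleC: "norm (scaleC c x) = cmod c * norm x"
    and star_star: "star (star x) = x"
    and star_add: "star (x + y) = star x + star y"
    and star_scaleC: "star (scaleC c x) = scaleC (cnj c) (star x)"
    and star_mult: "star (x * y) = star y * star x"
    and cstar_identity: "norm (star x * x) = (norm x)\<^sup>2"

instantiation complex :: comm_unital_cstar_algebra
begin

definition scaleC_complex :: "complex \<Rightarrow> complex \<Rightarrow> complex" where
  "scaleC_complex = (*)"

definition star_complex :: "complex \<Rightarrow> complex" where
  "star_complex = cnj"

instance
  by standard
    (simp_all add: scaleC_complex_def star_complex_def scaleR_conv_of_real algebra_simps
      norm_mult power2_eq_square)

end


section \<open>Hyper-C*-algebras\<close>

locale complex_vector_space_on =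
  fixes V :: "'v set"
    and add :: "'v \<Rightarrow> 'v \<Rightarrow> 'v"
    and zero :: 'v
    and scale :: "complex \<Rightarrow> 'v \<Rightarrow> 'v"
  assumes zero_closed: "zero \<in> V"
    and add_closed: "\<lbrakk>x \<in> V; y \<in> V\<rbrakk> \<Longrightarrow> add x y \<in> V"
    and scale_closed: "x \<in> V \<Longrightarrow> scale c x \<in> V"
    and add_assoc: "\<lbrakk>x \<in> V; y \<in> V; z \<in> V\<rbrakk> \<Longrightarrow> add (add x y) z = add x (add y z)"
    and add_commute: "\<lbrakk>x \<in> V; y \<in> V\<rbrakk> \<Longrightarrow> add x y = add y x"
    and add_zero: "x \<in> V \<Longrightarrow> add x zero = x"
    and add_inverse: "x \<in> V \<Longrightarrow> add x (scale (-1) x) = zero"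
    and scale_one: "x \<in> V \<Longrightarrow> scale 1 x = x"
    and scale_scale: "x \<in> V \<Longrightarrow> scale c (scale d x) = scale (c * d) x"
    and scale_add_left: "x \<in> V \<Longrightarrow> scale (c + d) x = add (scale c x) (scale d x)"
    and scale_add_right: "\<lbrakk>x \<in> V; y \<in> V\<rbrakk> \<Longrightarrow> scale c (add x y) = add (scale c x) (scale c y)"
begin

definition diff :: "'v \<Rightarrow> 'v \<Rightarrow> 'v" where
  "diff x y = add x (scale (-1) y)"

text \<open>The distance is set to \<open>0\<close> off the carrier because \<^locale>\<open>Metric_space\<close> asks
  for nonnegativity and symmetry on the whole type.\<close>

definition norm_dist :: "('v \<Rightarrow> real) \<Rightarrow> 'v \<Rightarrow> 'v \<Rightarrow> real" where
  "norm_dist nrm x y = (if x \<in> V \<and> y \<in> V then nrm (diff x y) else 0)"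

end

locale complete_tvs_on = complex_vector_space_on V add zero scale
  for V :: "'v set" and add zero scale +
  fixes T :: "'v topology"
  assumes topspace_eq: "topspace T = V"
    and continuous_add: "continuous_map (prod_topology T T) T (\<lambda>(x, y). add x y)"
    and continuous_scale:
      "continuous_map (prod_topology (euclidean :: complex topology) T) T (\<lambda>(c, x). scale c x)"
    and cauchy_filter_converges:
      "\<And>F :: 'v filter.
         \<lbrakk>F \<noteq> bot; F \<le> principal V;
          \<And>U. \<lbrakk>openin T U; zero \<in> U\<rbrakk> \<Longrightarrow> (\<forall>\<^sub>F (x, y) in F \<times>\<^sub>F F. diff x y \<in> U)\<rbrakk>
         \<Longrightarrow> \<exists>l. limitin T (\<lambda>x. x) l F"

locale cstar_algebra_on = complex_vector_space_on V add zero scale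
  for V :: "'v set" and add zero scale +
  fixes mult :: "'v \<Rightarrow> 'v \<Rightarrow> 'v"
    and inv :: "'v \<Rightarrow> 'v"
    and nrm :: "'v \<Rightarrow> real"
  assumes mult_closed: "\<lbrakk>x \<in> V; y \<in> V\<rbrakk> \<Longrightarrow> mult x y \<in> V"
    and mult_assoc: "\<lbrakk>x \<in> V; y \<in> V; z \<in> V\<rbrakk> \<Longrightarrow> mult (mult x y) z = mult x (mult y z)"
    and mult_add_left: "\<lbrakk>x \<in> V; y \<in> V; z \<in> V\<rbrakk> \<Longrightarrow> mult (add x y) z = add (mult x z) (mult y z)"
    and mult_add_right: "\<lbrakk>x \<in> V; y \<in> V; z \<in> V\<rbrakk> \<Longrightarrow> mult x (add y z) = add (mult x y) (mult x z)"
    and mult_scale_left: "\<lbrakk>x \<in> V; y \<in> V\<rbrakk> \<Longrightarrow> mult (scale c x) y = scale c (mult x y)"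
    and mult_scale_right: "\<lbrakk>x \<in> V; y \<in> V\<rbrakk> \<Longrightarrow> mult x (scale c y) = scale c (mult x y)"
    and inv_closed: "x \<in> V \<Longrightarrow> inv x \<in> V"
    and inv_inv: "x \<in> V \<Longrightarrow> inv (inv x) = x"
    and inv_add: "\<lbrakk>x \<in> V; y \<in> V\<rbrakk> \<Longrightarrow> inv (add x y) = add (inv x) (inv y)"
    and inv_scale: "x \<in> V \<Longrightarrow> inv (scale c x) = scale (cnj c) (inv x)"
    and inv_mult: "\<lbrakk>x \<in> V; y \<in> V\<rbrakk> \<Longrightarrow> inv (mult x y) = mult (inv y) (inv x)"
    and nrm_nonneg: "x \<in> V \<Longrightarrow> 0 \<le> nrm x"
    and nrm_eq_zero: "x \<in> V \<Longrightarrow> nrm x = 0 \<longleftrightarrow> x = zero"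
    and nrm_triangle: "\<lbrakk>x \<in> V; y \<in> V\<rbrakk> \<Longrightarrow> nrm (add x y) \<le> nrm x + nrm y"
    and nrm_scale: "x \<in> V \<Longrightarrow> nrm (scale c x) = cmod c * nrm x"
    and nrm_mult: "\<lbrakk>x \<in> V; y \<in> V\<rbrakk> \<Longrightarrow> nrm (mult x y) \<le> nrm x * nrm y"
    and nrm_cstar: "x \<in> V \<Longrightarrow> nrm (mult (inv x) x) = (nrm x)\<^sup>2"
    and nrm_complete: "Metric_space.mcomplete V (norm_dist nrm)"

text \<open>The multiplication/involution pairs form a family indexed by \<open>I\<close>, not a set of pairs:
  distinct indices may carry the same operations.\<close>

locale hyper_cstar_algebra = complete_tvs_on V add zero scale T
  for V :: "'v set" and add zero scale T +
  fixes I :: "'i set"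
    and mult :: "'i \<Rightarrow> 'v \<Rightarrow> 'v \<Rightarrow> 'v"
    and inv :: "'i \<Rightarrow> 'v \<Rightarrow> 'v"
  assumes finite_index: "finite I"
    and cstar_norm_exists:
      "i \<in> I \<Longrightarrow> \<exists>nrm. cstar_algebra_on V add zero scale (mult i) (inv i) nrm \<and>
                      Metric_space.mtopology V (norm_dist nrm) = T"


section \<open>Spaces of functions on an index set\<close>

text \<open>Functions \<open>S \<rightarrow> A\<close>, equivalently sections of the constant bundle \<open>S \<times> A\<close>, are
  represented by the elements of \<open>S \<rightarrow>\<^sub>E UNIV\<close>.\<close>

definition fun_add :: "'s set \<Rightarrow> ('s \<Rightarrow> 'a::comm_unital_cstar_algebra) \<Rightarrow> ('s \<Rightarrow> 'a) \<Rightarrow> 's \<Rightarrow> 'a" where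
  "fun_add S f g = (\<lambda>s\<in>S. f s + g s)"

definition fun_zero :: "'s set \<Rightarrow> 's \<Rightarrow> 'a::comm_unital_cstar_algebra" where
  "fun_zero S = (\<lambda>s\<in>S. 0)"

definition fun_scale :: "'s set \<Rightarrow> complex \<Rightarrow> ('s \<Rightarrow> 'a::comm_unital_cstar_algebra) \<Rightarrow> 's \<Rightarrow> 'a" where
  "fun_scale S c f = (\<lambda>s\<in>S. scaleC c (f s))"

definition fun_topology :: "'s set \<Rightarrow> ('s \<Rightarrow> 'a::comm_unital_cstar_algebra) topology" where
  "fun_topology S = product_topology (\<lambda>_. euclidean) S"


section \<open>Products of finite pair groupoids\<close>

definition pair_composable :: "'p \<times> 'p \<Rightarrow> 'p \<times> 'p \<Rightarrow> bool" where
  "pair_composable x y \<longleftrightarrow> snd x = fst y"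

definition pair_comp :: "'p \<times> 'p \<Rightarrow> 'p \<times> 'p \<Rightarrow> 'p \<times> 'p" where
  "pair_comp x y = (fst x, snd y)"

definition pair_inv :: "'p \<times> 'p \<Rightarrow> 'p \<times> 'p" where
  "pair_inv x = (snd x, fst x)"

definition pair_product :: "nat \<Rightarrow> (nat \<Rightarrow> nat) \<Rightarrow> (nat \<Rightarrow> nat \<times> nat) set" where
  "pair_product n N = (\<Pi>\<^sub>E k\<in>{1..n}. {1..N k} \<times> {1..N k})"

definition fd_composable ::
  "nat \<Rightarrow> nat set \<Rightarrow> (nat \<Rightarrow> nat \<times> nat) \<Rightarrow> (nat \<Rightarrow> nat \<times> nat) \<Rightarrow> bool" where
  "fd_composable n \<beta> x y \<longleftrightarrow>
     (\<forall>p\<in>\<beta>. x p = y p) \<and> (\<forall>p\<in>{1..n} - \<beta>. pair_composable (x p) (y p))"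

definition fd_comp ::
  "nat \<Rightarrow> nat set \<Rightarrow> (nat \<Rightarrow> nat \<times> nat) \<Rightarrow> (nat \<Rightarrow> nat \<times> nat) \<Rightarrow> nat \<Rightarrow> nat \<times> nat" where
  "fd_comp n \<beta> x y = (\<lambda>p\<in>{1..n}. if p \<in> \<beta> then x p else pair_comp (x p) (y p))"

definition fd_inv :: "nat \<Rightarrow> nat set \<Rightarrow> (nat \<Rightarrow> nat \<times> nat) \<Rightarrow> nat \<Rightarrow> nat \<times> nat" where
  "fd_inv n \<beta> x = (\<lambda>p\<in>{1..n}. if p \<in> \<beta> then x p else pair_inv (x p))"


section \<open>Convolution operations on sections\<close>

definition sections :: "nat \<Rightarrow> (nat \<Rightarrow> nat) \<Rightarrow> ((nat \<Rightarrow> nat \<times> nat) \<Rightarrow> 'a::comm_unital_cstar_algebra) set" where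
  "sections n N = (pair_product n N \<rightarrow>\<^sub>E UNIV)"

definition conv_mult ::
  "nat \<Rightarrow> (nat \<Rightarrow> nat) \<Rightarrow> nat set \<Rightarrow>
   ((nat \<Rightarrow> nat \<times> nat) \<Rightarrow> 'a::comm_unital_cstar_algebra) \<Rightarrow> ((nat \<Rightarrow> nat \<times> nat) \<Rightarrow> 'a) \<Rightarrow>
   (nat \<Rightarrow> nat \<times> nat) \<Rightarrow> 'a" where
  "conv_mult n N \<beta> \<sigma> \<rho> = (\<lambda>z\<in>pair_product n N.
     \<Sum>(x, y) \<in> {(x, y). x \<in> pair_product n N \<and> y \<in> pair_product n N \<and>
                        fd_composable n \<beta> x y \<and> fd_comp n \<beta> x y = z}. \<sigma> x * \<rho> y)"

definition conv_star ::
  "nat \<Rightarrow> (nat \<Rightarrow> nat) \<Rightarrow> nat set \<Rightarrow>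
   ((nat \<Rightarrow> nat \<times> nat) \<Rightarrow> 'a::comm_unital_cstar_algebra) \<Rightarrow> (nat \<Rightarrow> nat \<times> nat) \<Rightarrow> 'a" where
  "conv_star n N \<beta> \<sigma> = (\<lambda>z\<in>pair_product n N. star (\<sigma> (fd_inv n \<beta> z)))"


section \<open>Hypermatrices\<close>

text \<open>The entry with upper indices \<open>i\<close> and lower indices \<open>j\<close> of the hypermatrix \<open>x\<close>
  is \<open>x (i, j)\<close>.\<close>

definition multi_indices :: "nat \<Rightarrow> (nat \<Rightarrow> nat) \<Rightarrow> (nat \<Rightarrow> nat) set" where
  "multi_indices n N = (\<Pi>\<^sub>E k\<in>{1..n}. {1..N k})"

definition entries :: "nat \<Rightarrow> (nat \<Rightarrow> nat) \<Rightarrow> ((nat \<Rightarrow> nat) \<times> (nat \<Rightarrow> nat)) set" where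
  "entries n N = multi_indices n N \<times> multi_indices n N"

definition hypermatrices ::
  "nat \<Rightarrow> (nat \<Rightarrow> nat) \<Rightarrow> ((nat \<Rightarrow> nat) \<times> (nat \<Rightarrow> nat) \<Rightarrow> 'a::comm_unital_cstar_algebra) set" where
  "hypermatrices n N = (entries n N \<rightarrow>\<^sub>E UNIV)"

text \<open>\<open>replace_at n \<gamma> m i\<close> is \<open>i\<close> with the indices at the levels in \<open>\<gamma>\<close> replaced
  by those of \<open>m\<close>.\<close>

definition replace_at :: "nat \<Rightarrow> nat set \<Rightarrow> (nat \<Rightarrow> nat) \<Rightarrow> (nat \<Rightarrow> nat) \<Rightarrow> nat \<Rightarrow> nat" where
  "replace_at n \<gamma> m i = (\<lambda>k\<in>{1..n}. if k \<in> \<gamma> then m k else i k)"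

definition hyp_mult ::
  "nat \<Rightarrow> (nat \<Rightarrow> nat) \<Rightarrow> nat set \<Rightarrow>
   ((nat \<Rightarrow> nat) \<times> (nat \<Rightarrow> nat) \<Rightarrow> 'a::comm_unital_cstar_algebra) \<Rightarrow>
   ((nat \<Rightarrow> nat) \<times> (nat \<Rightarrow> nat) \<Rightarrow> 'a) \<Rightarrow> (nat \<Rightarrow> nat) \<times> (nat \<Rightarrow> nat) \<Rightarrow> 'a" where
  "hyp_mult n N \<gamma> x y = restrict (\<lambda>(i, j).
     \<Sum>m \<in> (\<Pi>\<^sub>E k\<in>\<gamma>. {1..N k}). x (i, replace_at n \<gamma> m j) * y (replace_at n \<gamma> m i, j)) (entries n N)"

definition hyp_star ::
  "nat \<Rightarrow> (nat \<Rightarrow> nat) \<Rightarrow> nat set \<Rightarrow>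
   ((nat \<Rightarrow> nat) \<times> (nat \<Rightarrow> nat) \<Rightarrow> 'a::comm_unital_cstar_algebra) \<Rightarrow>
   (nat \<Rightarrow> nat) \<times> (nat \<Rightarrow> nat) \<Rightarrow> 'a" where
  "hyp_star n N \<gamma> x = restrict (\<lambda>(i, j).
     star (x (replace_at n \<gamma> j i, replace_at n \<gamma> i j))) (entries n N)"


section \<open>The identification of hypermatrices with sections\<close>

definition section_of ::
  "nat \<Rightarrow> (nat \<Rightarrow> nat) \<Rightarrow> ((nat \<Rightarrow> nat) \<times> (nat \<Rightarrow> nat) \<Rightarrow> 'a::comm_unital_cstar_algebra) \<Rightarrow>
   (nat \<Rightarrow> nat \<times> nat) \<Rightarrow> 'a" where
  "section_of n N x = (\<lambda>z\<in>pair_product n N. x (\<lambda>k\<in>{1..n}. fst (z k), \<lambda>k\<in>{1..n}. snd (z k)))"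

end

theory Submission
  imports Defs
begin

text \<open>The identification of a hypermatrix with a section is a relabelling of indices: an entry is
  a pair of multi-indices, an arrow of the product groupoid is a multi-index of pairs. Under it, a
  factorization of an arrow \<open>z\<close> for the composition indexed by \<open>\<beta>\<close> is forced at the levels in
  \<open>\<beta>\<close> (both factors agree with \<open>z\<close>), and at each remaining level it is the choice of one
  intermediate index. Thus the convolution sum is the sum over intermediate indices at the levels in
  the complement of \<open>\<beta>\<close> (\<open>section_of_hyp_mult\<close>, \<open>section_of_hyp_star\<close>). What needs
  work is that these operations are C*-algebra structures inducing the product topology.

  For a fixed \<open>\<beta>\<close> the composition makes the index set a finite groupoid (a product of pair
  groupoids and discrete groupoids), so it suffices to treat the convolution algebra of a finite groupoid
  \<open>G\<close> with values in \<open>A\<close>. For complex values, convolution is an action on the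
  finite-dimensional Hilbert space of functions on \<open>G\<close>, the adjoint of the action of \<open>f\<close> being
  the action of \<open>f\<^sup>*\<close> (\<open>inner_conv\<close>), and the operator norm is a C*-norm. For values in
  \<open>A\<close>, take the supremum of the operator norms of \<open>\<phi> \<circ> f\<close> over all characters \<open>\<phi>\<close> of
  \<open>A\<close>. Since characters attain the norm of any element (\<open>character_attains_norm\<close>), this
  norm dominates every \<open>\<parallel>f x\<parallel>\<close>; it is also dominated by a multiple of
  their sum, so it is complete and induces the product topology (\<open>entrywise_bounded_norm\<close>).

  The existence of enough characters is Gelfand's theorem. It is obtained here without quotient algebras
  and without spectral theory. A seminorm with \<open>p (x * x) = (p x)\<^sup>2\<close> which is minimal is
  multiplicative, as otherwise localizing it at an element would make it smaller; and a multiplicative seminorm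
  is the absolute value of a character by Ostrowski's elementary proof of the Gelfand--Mazur theorem.\<close>

section \<open>Characters of commutative unital C*-algebras\<close>

definition scalar :: "complex \<Rightarrow> 'a::comm_unital_cstar_algebra" where
  "scalar c = scaleC c 1"

lemma scaleC_eq_scalar_mult: "scaleC c x = scalar c * (x::'a::comm_unital_cstar_algebra)"
  by (simp add: scalar_def mult_scaleC_left)

lemma scaleC_one: "scaleC 1 (x::'a::comm_unital_cstar_algebra) = x"
  using scaleC_of_real[of 1 x] by simp

lemma scaleC_minus_one: "scaleC (-1) (x::'a::comm_unital_cstar_algebra) = - x"
  using scaleC_of_real[of "-1" x] by simp

lemma scalar_0: "scalar 0 = (0::'a::comm_unital_cstar_algebra)"
  using scaleC_of_real[of 0 "1::'a"] by (simp add: scalar_def)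

lemma scalar_add: "scalar (c + d) = (scalar c + scalar d::'a::comm_unital_cstar_algebra)"
  by (simp add: scalar_def scaleC_add_left)

lemma scalar_mult: "scalar (c * d) = (scalar c * scalar d::'a::comm_unital_cstar_algebra)"
  by (metis scalar_def scaleC_scaleC scaleC_eq_scalar_mult)

lemma scalar_minus: "scalar (- c) = (- scalar c::'a::comm_unital_cstar_algebra)"
  using scalar_add[of c "-c", where ?'a='a] by (simp add: scalar_0 eq_neg_iff_add_eq_0 add.commute)

lemma scalar_diff: "scalar (c - d) = (scalar c - scalar d::'a::comm_unital_cstar_algebra)"
  using scalar_add[of c "-d", where ?'a='a] by (simp add: scalar_minus)

lemma scaleC_zero_right: "scaleC c 0 = (0::'a::comm_unital_cstar_algebra)"
  by (simp add: scaleC_eq_scalar_mult)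

lemma star_one: "star 1 = (1::'a::comm_unital_cstar_algebra)"
  by (metis star_mult star_star mult.right_neutral mult.left_neutral)

lemma star_scalar: "star (scalar c) = (scalar (cnj c) :: 'a::comm_unital_cstar_algebra)"
  by (simp add: scalar_def star_scaleC star_one)

lemma star_zero: "star 0 = (0::'a::comm_unital_cstar_algebra)"
  by (metis add_cancel_right_left star_add)

text \<open>The C*-identity, applied to \<open>x * x\<close> and to the self-adjoint element \<open>x\<^sup>* x\<close>,
  yields the square property because all elements commute.\<close>

lemma norm_square: "norm (x * x) = (norm (x::'a::comm_unital_cstar_algebra))\<^sup>2"
proof -
  let ?h = "star x * x"
  have "(norm (x * x))\<^sup>2 = norm (star (x * x) * (x * x))" by (simp add: cstar_identity)
  also have "star (x * x) * (x * x) = star ?h * ?h"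
    by (simp add: star_mult star_star algebra_simps)
  also have "norm (star ?h * ?h) = (norm ?h)\<^sup>2" by (rule cstar_identity)
  also have "\<dots> = ((norm x)\<^sup>2)\<^sup>2" by (simp add: cstar_identity)
  finally show ?thesis by (rule power2_eq_imp_eq) auto
qed

lemma norm_one_if_nonzero:
  assumes "(a::'a::comm_unital_cstar_algebra) \<noteq> 0" shows "norm (1::'a) = 1"
proof -
  have "norm (1::'a) = (norm (1::'a))\<^sup>2" using norm_square[of "1::'a"] by simp
  moreover have "norm (1::'a) \<noteq> 0" using assms by (metis mult_zero_left mult_1 norm_eq_zero)
  ultimately show ?thesis by (simp add: power2_eq_square)
qed

text \<open>These are the seminorms \<open>x \<mapsto> sup \<bar>\<phi> x\<bar>\<close> over nonempty closed sets of nonzero characters;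
  the multiplicative ones correspond to single points.\<close>

locale uniform_seminorm =
  fixes p :: "'a::comm_unital_cstar_algebra \<Rightarrow> real"
  assumes le_norm: "p x \<le> norm x"
    and nonneg: "0 \<le> p x"
    and triangle: "p (x + y) \<le> p x + p y"
    and scaleC: "p (scaleC c x) = cmod c * p x"
    and mult_le: "p (x * y) \<le> p x * p y"
    and square: "p (x * x) = (p x)\<^sup>2"
    and one: "p 1 = 1"
begin

lemma zero: "p 0 = 0"
  using scaleC[of 0 0] by (simp add: scaleC_zero_right)

lemma minus: "p (- x) = p x"
  using scaleC[of "-1" x] by (simp add: scaleC_minus_one)

lemma scalar: "p (scalar c) = cmod c"
  by (simp add: scalar_def scaleC one)

lemma diff_triangle: "p (x - y) \<le> p x + p y"
  using triangle[of x "-y"] by (simp add: minus)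

lemma diff_ge: "p x - p y \<le> p (x - y)"
  using triangle[of "x - y" y] by simp

text \<open>The square property makes \<open>n \<mapsto> p (x ^ n)\<close> logarithmically convex, while submultiplicativity
  bounds it by \<open>p x ^ n\<close>; as both agree for the exponents 0 and 1, they agree everywhere.\<close>

lemma power: "p (x ^ n) = p x ^ n"
proof (induction n rule: less_induct)
  case (less n)
  consider "n = 0" | "n = 1" | k where "n = Suc (Suc k)" by (metis One_nat_def not0_implies_Suc)
  then show ?case
  proof cases
    case (3 k)
    have le: "p (x ^ m) \<le> p x ^ m" for m
      by (induction m) (auto simp: one intro: order_trans[OF mult_le] mult_left_mono nonneg)
    show ?thesis
    proof (cases "p x = 0")
      case False
      have "(p x ^ Suc k)\<^sup>2 = p (x ^ Suc k * x ^ Suc k)"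
        unfolding square using less[of "Suc k"] 3 by simp
      also have "x ^ Suc k * x ^ Suc k = x ^ k * x ^ n"
        using 3 by (simp add: algebra_simps)
      also have "p \<dots> \<le> p (x ^ k) * p (x ^ n)" by (rule mult_le)
      also have "p (x ^ k) = p x ^ k" using less 3 by simp
      also have "(p x ^ Suc k)\<^sup>2 = p x ^ k * p x ^ n"
        using 3 by (simp add: power2_eq_square algebra_simps)
      finally have "p x ^ n \<le> p (x ^ n)" using False nonneg[of x] by simp
      then show ?thesis using le[of n] by simp
    next
      case True
      then show ?thesis using le[of n] nonneg[of "x ^ n"] 3 by simp
    qed
  qed (auto simp: one)
qed

text \<open>Localization at \<open>b\<close> restricts the supremum to those characters at which \<open>\<bar>b\<bar>\<close> is maximal:
  the weights \<open>(\<bar>b\<bar> / p b)\<^sup>n\<close> suppress all the others. The quotients decrease in \<open>n\<close>,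
  so that the limit exists.\<close>

definition localized :: "'a \<Rightarrow> 'a \<Rightarrow> real" where
  "localized b x = lim (\<lambda>n. p (x * b ^ n) / p b ^ n)"

lemma localized_tendsto:
  assumes "p b > 0"
  shows "(\<lambda>n. p (x * b ^ n) / p b ^ n) \<longlonglongrightarrow> localized b x"
proof -
  have "decseq (\<lambda>n. p (x * b ^ n) / p b ^ n)"
  proof (rule decseq_SucI)
    fix n
    have "p (x * b ^ Suc n) \<le> p (x * b ^ n) * p b"
      using mult_le[of "x * b ^ n" b] by (simp add: algebra_simps)
    then show "p (x * b ^ Suc n) / p b ^ Suc n \<le> p (x * b ^ n) / p b ^ n"
      using assms by (simp add: field_simps)
  qed
  then have "convergent (\<lambda>n. p (x * b ^ n) / p b ^ n)"
    by (rule decseq_convergent[of _ 0]) (auto simp: nonneg convergent_def intro!: divide_nonneg_nonneg)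
  then show ?thesis by (simp add: localized_def convergent_LIMSEQ_iff)
qed

lemma localized_le:
  assumes "p b > 0" shows "localized b x \<le> p x"
proof (rule LIMSEQ_le_const2[OF localized_tendsto[OF assms]], intro exI allI impI)
  fix n
  have "p (x * b ^ n) \<le> p x * p b ^ n" using mult_le[of x "b ^ n"] by (simp add: power)
  then show "p (x * b ^ n) / p b ^ n \<le> p x" using assms by (simp add: field_simps)
qed

text \<open>Localizing preserves multiplicativity that has been gained earlier. This lets the minimal seminorm below
  retain the prescribed value at one chosen element.\<close>

lemma localized_mult:
  assumes b: "p b > 0" and a: "\<And>x. p (x * a) = p x * r"
  shows "localized b (x * a) = localized b x * r"
proof (rule LIMSEQ_unique[OF localized_tendsto[OF b]])
  have "(\<lambda>n. p (x * b ^ n) / p b ^ n * r) \<longlonglongrightarrow> localized b x * r"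
    by (intro tendsto_intros localized_tendsto b)
  moreover have "p (x * a * b ^ n) = p (x * b ^ n) * r" for n
    using a[of "x * b ^ n"] by (simp add: algebra_simps)
  ultimately show "(\<lambda>n. p (x * a * b ^ n) / p b ^ n) \<longlonglongrightarrow> localized b x * r" by simp
qed

lemma localized_mult_self:
  assumes b: "p b > 0"
  shows "localized b (x * b) = localized b x * p b"
proof (rule LIMSEQ_unique[OF localized_tendsto[OF b]])
  have "(\<lambda>n. p (x * b ^ Suc n) / p b ^ Suc n * p b) \<longlonglongrightarrow> localized b x * p b"
    by (intro tendsto_intros LIMSEQ_Suc localized_tendsto b)
  moreover have "p (x * b ^ Suc n) / p b ^ Suc n * p b = p (x * b * b ^ n) / p b ^ n" for n
    using b by (simp add: algebra_simps)
  ultimately show "(\<lambda>n. p (x * b * b ^ n) / p b ^ n) \<longlonglongrightarrow> localized b x * p b" by simp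
qed

lemma uniform_seminorm_localized:
  assumes b: "p b > 0" shows "uniform_seminorm (localized b)"
proof
  note L = localized_tendsto[OF b]
  have L2: "(\<lambda>n. p (x * b ^ (2 * n)) / p b ^ (2 * n)) \<longlonglongrightarrow> localized b x" for x
    using LIMSEQ_subseq_LIMSEQ[OF L[of x], of "\<lambda>n. 2 * n"] by (simp add: strict_mono_def o_def)
  fix x y and c :: complex
  show "localized b x \<le> norm x" using localized_le[OF b, of x] le_norm[of x] by simp
  show "0 \<le> localized b x"
    by (rule LIMSEQ_le_const[OF L]) (use b nonneg in auto)
  show "localized b (x + y) \<le> localized b x + localized b y"
  proof (rule LIMSEQ_le[OF L tendsto_add[OF L L]], intro exI allI impI)
    fix n
    show "p ((x + y) * b ^ n) / p b ^ n \<le> p (x * b ^ n) / p b ^ n + p (y * b ^ n) / p b ^ n"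
      using triangle[of "x * b ^ n" "y * b ^ n"] b
      by (simp add: add_divide_distrib[symmetric] divide_right_mono distrib_right)
  qed
  show "localized b (scaleC c x) = cmod c * localized b x"
    by (rule LIMSEQ_unique[OF L])
      (use tendsto_mult_left[OF L[of x], of "cmod c"] in \<open>simp add: mult_scaleC_left scaleC\<close>)
  show "localized b (x * y) \<le> localized b x * localized b y"
  proof (rule LIMSEQ_le[OF L2 tendsto_mult[OF L L]], intro exI allI impI)
    fix n
    have "p (x * y * b ^ (2 * n)) \<le> p (x * b ^ n) * p (y * b ^ n)"
      using mult_le[of "x * b ^ n" "y * b ^ n"] unfolding mult_2 power_add by (simp add: mult_ac)
    then show "p (x * y * b ^ (2 * n)) / p b ^ (2 * n) \<le> p (x * b ^ n) / p b ^ n * (p (y * b ^ n) / p b ^ n)"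
      using b by (simp add: mult_2 power_add divide_right_mono)
  qed
  show "localized b (x * x) = (localized b x)\<^sup>2"
  proof (rule LIMSEQ_unique[OF L2])
    have "p (x * x * b ^ (2 * n)) = (p (x * b ^ n))\<^sup>2" for n
      using square[of "x * b ^ n"] unfolding mult_2 power_add by (simp add: mult_ac)
    then have "p (x * x * b ^ (2 * n)) / p b ^ (2 * n) = (p (x * b ^ n) / p b ^ n)\<^sup>2" for n
      by (simp add: power_divide power_even_eq)
    then show "(\<lambda>n. p (x * x * b ^ (2 * n)) / p b ^ (2 * n)) \<longlonglongrightarrow> (localized b x)\<^sup>2"
      using tendsto_power[OF L[of x], of 2] by simp
  qed
  show "localized b 1 = 1"
    by (rule LIMSEQ_unique[OF L]) (use b in \<open>simp add: power\<close>)
qed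

end

lemma uniform_seminorm_norm:
  assumes "(a::'a::comm_unital_cstar_algebra) \<noteq> 0"
  shows "uniform_seminorm (norm :: 'a \<Rightarrow> real)"
  by standard (auto simp: norm_triangle_ineq norm_scaleC norm_mult_ineq norm_square
      norm_one_if_nonzero[OF assms])

text \<open>Zorn's lemma is applied to the seminorms \<open>q\<close> with \<open>q (x * a) = q x * \<parallel>a\<parallel>\<close>, ordered downwards.
  The localization of the norm at \<open>a\<close> is one of them. A minimal one equals its localization at every
  \<open>b\<close> with \<open>q b > 0\<close>, which says that it is multiplicative; and \<open>x = 1\<close> gives \<open>q a = \<parallel>a\<parallel>\<close>.
  The constraint is needed because minimality alone could lower the value at \<open>a\<close>.\<close>

lemma exists_multiplicative_seminorm:
  assumes a: "(a::'a::comm_unital_cstar_algebra) \<noteq> 0"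
  shows "\<exists>q. uniform_seminorm q \<and> q a = norm a \<and> (\<forall>x y. q (x * y) = q x * q y)"
proof -
  interpret N: uniform_seminorm "norm :: 'a \<Rightarrow> real" by (rule uniform_seminorm_norm[OF a])
  define A where "A = {q. uniform_seminorm q \<and> (\<forall>x. q (x * a) = q x * norm a)}"
  let ?P = "\<lambda>q q' :: 'a \<Rightarrow> real. q' \<le> q"
  have "N.localized a \<in> A"
    using a by (simp add: A_def N.uniform_seminorm_localized N.localized_mult_self)
  have "\<exists>m\<in>A. \<forall>q\<in>A. ?P m q \<longrightarrow> q = m"
  proof (rule predicate_Zorn)
    show "partial_order_on A (relation_of ?P A)"
      by (rule partial_order_on_relation_ofI) auto
    fix C assume C: "C \<in> Chains (relation_of ?P A)"
    then have CA: "C \<subseteq> A" by (auto simp: Chains_def relation_of_def)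
    have tot: "q \<le> q' \<or> q' \<le> q" if "q \<in> C" "q' \<in> C" for q q'
      using C that by (auto simp: Chains_def relation_of_def)
    show "\<exists>u\<in>A. \<forall>q\<in>C. ?P q u"
    proof (cases "C = {}")
      case True
      then show ?thesis using \<open>N.localized a \<in> A\<close> by auto
    next
      case False
      define u where "u x = (INF q\<in>C. q x)" for x
      have us: "uniform_seminorm q" if "q \<in> C" for q using that CA by (auto simp: A_def)
      have bdd: "bdd_below ((\<lambda>q. q x) ` C)" for x
        using us by (auto intro!: bdd_belowI[of _ 0] simp: uniform_seminorm.nonneg)
      have le: "u x \<le> q x" if "q \<in> C" for q x
        unfolding u_def by (rule cINF_lower[OF bdd that])
      have ge: "c \<le> u x" if "\<And>q. q \<in> C \<Longrightarrow> c \<le> q x" for c x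
        unfolding u_def by (rule cINF_greatest[OF False that])
      have dir: "\<exists>q''\<in>C. q'' \<le> q \<and> q'' \<le> q'" if "q \<in> C" "q' \<in> C" for q q'
        using tot that by blast
      have u0: "0 \<le> u x" for x using ge us by (meson uniform_seminorm.nonneg)
      have approx: "\<exists>q\<in>C. q x < u x + e \<and> q y < u y + e" if e: "e > 0" for x y e
      proof -
        obtain q where q: "q \<in> C" "q x < u x + e"
          using cINF_less_iff[OF False bdd, of x "u x + e"] e by (auto simp: u_def)
        obtain q' where q': "q' \<in> C" "q' y < u y + e"
          using cINF_less_iff[OF False bdd, of y "u y + e"] e by (auto simp: u_def)
        obtain q'' where "q'' \<in> C" "q'' \<le> q" "q'' \<le> q'" using dir q q' by blast
        then show ?thesis using q q' by (meson le_fun_def le_less_trans)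
      qed
      \<comment> \<open>In a chain the infimum at two points is approached along a single sequence, so all identities
        and inequalities between values pass to the infimum.\<close>
      have lim: "\<exists>f. (\<forall>n. f n \<in> C) \<and> (\<lambda>n. f n x) \<longlonglongrightarrow> u x \<and> (\<lambda>n. f n y) \<longlonglongrightarrow> u y" for x y
      proof -
        have "\<forall>n. \<exists>q\<in>C. q x < u x + inverse (Suc n) \<and> q y < u y + inverse (Suc n)"
          using approx by simp
        then obtain f where f: "\<And>n. f n \<in> C" "\<And>n. f n x \<le> u x + inverse (Suc n)"
            "\<And>n. f n y \<le> u y + inverse (Suc n)"
          by (metis less_imp_le)
        have "(\<lambda>n. f n z) \<longlonglongrightarrow> u z" if "\<And>n. f n z \<le> u z + inverse (Suc n)" for z
        proof (rule tendsto_sandwich[where f = "\<lambda>_. u z"])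
          show "(\<lambda>n. u z + inverse (Suc n)) \<longlonglongrightarrow> u z"
            using LIMSEQ_inverse_real_of_nat_add by simp
        qed (use that le f(1) in auto)
        then show ?thesis using f by blast
      qed
      have ueq: "u x = r * u y" if "\<And>q. q \<in> C \<Longrightarrow> q x = r * q y" for x y r
      proof -
        obtain f where f: "\<And>n. f n \<in> C" "(\<lambda>n. f n x) \<longlonglongrightarrow> u x" "(\<lambda>n. f n y) \<longlonglongrightarrow> u y"
          using lim by blast
        have "(\<lambda>n. f n x) \<longlonglongrightarrow> r * u y"
          using tendsto_mult_left[OF f(3), of r] that f(1) by simp
        then show ?thesis using f(2) LIMSEQ_unique by blast
      qed
      have "uniform_seminorm u"
      proof
        fix x y and c :: complex
        obtain q0 where q0: "q0 \<in> C" using False by blast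
        show "u x \<le> norm x" using le[OF q0] uniform_seminorm.le_norm[OF us[OF q0]] by (meson order_trans)
        show "0 \<le> u x" by (rule u0)
        obtain f where f: "\<And>n. f n \<in> C" "(\<lambda>n. f n x) \<longlonglongrightarrow> u x" "(\<lambda>n. f n y) \<longlonglongrightarrow> u y"
          using lim by blast
        show "u (x + y) \<le> u x + u y"
          by (rule LIMSEQ_le_const[OF tendsto_add[OF f(2,3)]])
            (meson f(1) le uniform_seminorm.triangle[OF us] order_trans)
        show "u (x * y) \<le> u x * u y"
          by (rule LIMSEQ_le_const[OF tendsto_mult[OF f(2,3)]])
            (meson f(1) le uniform_seminorm.mult_le[OF us] order_trans)
        show "u (scaleC c x) = cmod c * u x"
          by (rule ueq) (simp add: uniform_seminorm.scaleC us)
        obtain g where g: "\<And>n. g n \<in> C" "(\<lambda>n. g n x) \<longlonglongrightarrow> u x" "(\<lambda>n. g n (x * x)) \<longlonglongrightarrow> u (x * x)"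
          using lim by blast
        have "(\<lambda>n. g n (x * x)) \<longlonglongrightarrow> (u x)\<^sup>2"
          using tendsto_power[OF g(2), of 2] uniform_seminorm.square[OF us[OF g(1)]] by simp
        then show "u (x * x) = (u x)\<^sup>2" using g(3) LIMSEQ_unique by blast
        show "u 1 = 1"
          unfolding u_def using False by (simp add: uniform_seminorm.one us)
      qed
      moreover have "u (x * a) = u x * norm a" for x
      proof -
        have "q (x * a) = norm a * q x" if "q \<in> C" for q
          using that CA by (auto simp: A_def)
        then show ?thesis using ueq[of "x * a" "norm a" x] by simp
      qed
      ultimately have "u \<in> A" by (simp add: A_def)
      then show ?thesis using le by (auto simp: le_fun_def)
    qed
  qed
  then obtain m where m: "m \<in> A" and min: "\<And>q. q \<in> A \<Longrightarrow> q \<le> m \<Longrightarrow> q = m" by blast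
  interpret m: uniform_seminorm m using m by (simp add: A_def)
  have "m (x * b) = m x * m b" for x b
  proof (cases "m b = 0")
    case True
    then show ?thesis using m.mult_le[of x b] m.nonneg[of "x * b"] by simp
  next
    case False
    then have b: "m b > 0" using m.nonneg[of b] by simp
    have "m.localized b \<in> A"
      using m b by (auto simp: A_def m.uniform_seminorm_localized intro!: m.localized_mult)
    then have "m.localized b = m" using min m.localized_le[OF b] by (auto simp: le_fun_def)
    then show ?thesis using m.localized_mult_self[OF b] by simp
  qed
  moreover have "m a = norm a" using m m.one by (auto simp: A_def dest: spec[of _ 1])
  ultimately show ?thesis using m.uniform_seminorm_axioms by blast
qed

text \<open>Ostrowski's argument. The distance \<open>p (x - c)\<close> from the scalars attains a minimum \<open>m\<close>. If
  \<open>m > 0\<close> and the minimum is attained at \<open>d\<close>, put \<open>y = x - d\<close>. For a scalar \<open>c\<close> with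
  \<open>\<bar>c\<bar> < m\<close>, factoring \<open>y\<^sup>n - c\<^sup>n\<close> into \<open>y - c\<close> and \<open>n - 1\<close> further factors of
  size at least \<open>m\<close> shows \<open>m\<^sup>n\<^sup>-\<^sup>1 * p (y - c) \<le> m\<^sup>n + \<bar>c\<bar>\<^sup>n\<close>, and letting \<open>n\<close> grow, the
  minimum is attained at \<open>d + c\<close> too. Repeating this, it is attained at points arbitrarily far away, which
  is absurd. Only exponents \<open>n = 2\<^sup>k\<close> are used, for which square roots suffice to factor.\<close>

lemma (in uniform_seminorm) gelfand_mazur:
  assumes mult: "\<And>x y. p (x * y) = p x * p y"
  shows "\<exists>c. p (x - scalar c) = 0"
proof -
  define f where "f c = p (x - scalar c)" for c
  have lip: "f c \<le> f d + cmod (c - d)" for c d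
  proof -
    have "x - scalar c = x - scalar d + scalar (d - c)" by (simp add: scalar_diff)
    then show ?thesis
      using triangle[of "x - scalar d" "scalar (d - c)"]
      by (simp only: f_def scalar norm_minus_commute)
  qed
  have "continuous_on UNIV f"
    unfolding continuous_on_iff
  proof (intro ballI allI impI)
    fix c :: complex and e :: real assume "e > 0"
    moreover have "dist (f d) (f c) \<le> dist d c" for d
      using lip[of c d] lip[of d c] by (simp add: dist_norm norm_minus_commute abs_le_iff)
    ultimately show "\<exists>\<delta>>0. \<forall>d\<in>UNIV. dist d c < \<delta> \<longrightarrow> dist (f d) (f c) < e"
      by (meson le_less_trans)
  qed
  then have "continuous_on (cball 0 (2 * p x)) f" by (rule continuous_on_subset) simp
  then have "\<exists>c0\<in>cball 0 (2 * p x). \<forall>c\<in>cball 0 (2 * p x). f c0 \<le> f c"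
    using nonneg[of x] by (intro continuous_attains_inf) auto
  then obtain c0 where c0: "\<And>c. c \<in> cball 0 (2 * p x) \<Longrightarrow> f c0 \<le> f c" by blast
  have min: "f c0 \<le> f c" for c
  proof (cases "cmod c \<le> 2 * p x")
    case True
    then show ?thesis using c0 by simp
  next
    case False
    have "f c0 \<le> f 0" using c0 nonneg[of x] by simp
    also have "\<dots> = p x" by (simp add: f_def scalar_0)
    also have "\<dots> \<le> f c"
      using diff_ge[of "scalar c" x] False minus[of "x - scalar c"] by (simp add: f_def scalar)
    finally show ?thesis .
  qed
  define m where "m = f c0"
  have "m = 0"
  proof (rule ccontr)
    assume "m \<noteq> 0"
    then have m: "m > 0" using nonneg by (simp add: m_def f_def less_le)
    have step: "f (d + c) = m" if d: "f d = m" and c: "cmod c < m" for c d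
    proof -
      define y where "y = x - scalar d"
      have y: "p y = m" using d by (simp add: y_def f_def)
      have lb: "m \<le> p (y - scalar e)" for e
        using min[of "d + e"] by (simp add: y_def f_def m_def scalar_add algebra_simps)
      have lb2: "m ^ (2 ^ k) \<le> p (y ^ (2 ^ k) - scalar e)" for k e
      proof (induction k arbitrary: e)
        case (Suc k)
        define r where "r = csqrt e"
        have "y ^ (2 ^ Suc k) - scalar e = (y ^ (2 ^ k) - scalar r) * (y ^ (2 ^ k) - scalar (- r))"
          using scalar_mult[of r r, where ?'a='a] power2_csqrt[of e]
          by (simp add: r_def scalar_minus algebra_simps power2_eq_square mult_2 power_add)
        then show ?case
          using mult_mono[OF Suc Suc, of r "- r"] m nonneg
          by (simp add: mult power_add mult_2)
      qed (simp add: lb)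
      have lb3: "m ^ (2 ^ k) * p (y - scalar c) \<le> m * p (y ^ (2 ^ k) - scalar (c ^ (2 ^ k)))" for k
      proof (induction k)
        case (Suc k)
        let ?d = "c ^ (2 ^ k)"
        have "y ^ (2 ^ Suc k) - scalar (c ^ (2 ^ Suc k)) = (y ^ (2 ^ k) - scalar ?d) * (y ^ (2 ^ k) - scalar (- ?d))"
          using scalar_mult[of ?d ?d, where ?'a='a]
          by (simp add: scalar_minus algebra_simps power_add mult_2)
        moreover have "m ^ (2 ^ k) * p (y - scalar c) * m ^ (2 ^ k) \<le>
            m * p (y ^ (2 ^ k) - scalar ?d) * p (y ^ (2 ^ k) - scalar (- ?d))"
          using m nonneg by (intro mult_mono Suc lb2) auto
        ultimately show ?case by (simp add: mult power_add mult_2 mult_ac)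
      qed simp
      have "p (y - scalar c) \<le> m + m * (cmod c / m) ^ (2 ^ k)" for k
      proof -
        have "m ^ (2 ^ k) * p (y - scalar c) \<le> m * (m ^ (2 ^ k) + cmod c ^ (2 ^ k))"
          using lb3[of k] diff_triangle[of "y ^ (2 ^ k)" "scalar (c ^ (2 ^ k))"] m
          by (smt (verit) mult_left_mono power scalar y norm_power)
        then show ?thesis using m by (simp add: field_simps)
      qed
      moreover have "(\<lambda>k. m + m * (cmod c / m) ^ (2 ^ k)) \<longlonglongrightarrow> m + m * 0"
      proof (intro tendsto_intros)
        have "(\<lambda>k. (cmod c / m) ^ k) \<longlonglongrightarrow> 0" using c m by (intro LIMSEQ_realpow_zero) auto
        then show "(\<lambda>k. (cmod c / m) ^ (2 ^ k)) \<longlonglongrightarrow> 0"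
          using LIMSEQ_subseq_LIMSEQ[of _ 0 "\<lambda>k. 2 ^ k"] by (simp add: strict_mono_def o_def)
      qed
      ultimately have "p (y - scalar c) \<le> m" by (intro LIMSEQ_le_const[of _ m]) auto
      then show ?thesis
        using lb[of c] by (simp add: y_def f_def scalar_add algebra_simps)
    qed
    \<comment> \<open>Five steps of length \<open>m / 2\<close> lead to a scalar whose distance from \<open>x\<close> exceeds \<open>m\<close>.\<close>
    have walk: "f (c0 + of_nat j * of_real (m / 2)) = m" for j
    proof (induction j)
      case (Suc j)
      have "cmod (of_real (m / 2)) < m" using m by (simp add: norm_divide)
      from step[OF Suc this] show ?case by (simp add: algebra_simps add_divide_distrib)
    qed (simp add: m_def)
    define e :: complex where "e = of_nat 5 * of_real (m / 2)"
    have "f (c0 + e) = p (scalar e - (x - scalar c0))"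
      using minus[of "(x - scalar c0) - scalar e"] by (simp add: f_def scalar_add algebra_simps)
    then have "p (scalar e) - p (x - scalar c0) \<le> f (c0 + e)"
      using diff_ge[of "scalar e" "x - scalar c0"] by simp
    moreover have "p (scalar e) = 5 * m / 2"
      using m by (simp add: e_def scalar norm_mult norm_divide)
    ultimately show False using walk[of 5] m by (simp add: e_def m_def f_def)
  qed
  then show ?thesis unfolding m_def f_def by blast
qed

text \<open>The zero functional is admitted. It acts by zero, so it does not change a supremum of norms over all
  characters, and the zero algebra has no other.\<close>

locale character =
  fixes \<phi> :: "'a::comm_unital_cstar_algebra \<Rightarrow> complex"
  assumes add: "\<phi> (x + y) = \<phi> x + \<phi> y"
    and scaleC: "\<phi> (scaleC c x) = c * \<phi> x"
    and mult: "\<phi> (x * y) = \<phi> x * \<phi> y"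
    and star: "\<phi> (star x) = cnj (\<phi> x)"
    and norm_le: "cmod (\<phi> x) \<le> norm x"
begin

lemma zero: "\<phi> 0 = 0"
  using add[of 0 0] by simp

lemma sum: "\<phi> (sum f S) = (\<Sum>s\<in>S. \<phi> (f s))"
  by (induction S rule: infinite_finite_induct) (auto simp: zero add)

end

text \<open>Arens' trick: for real \<open>t\<close>, the C*-identity bounds \<open>\<bar>\<phi> (h + i t)\<bar>\<^sup>2\<close> by
  \<open>\<parallel>h\<parallel>\<^sup>2 + t\<^sup>2\<close>, whereas it is at least \<open>(Im (\<phi> h) + t)\<^sup>2\<close>, whose term linear
  in \<open>t\<close> must therefore vanish.\<close>

lemma selfadjoint_multiplicative_functional_real:
  fixes \<phi> :: "'a::comm_unital_cstar_algebra \<Rightarrow> complex"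
  assumes add: "\<And>x y. \<phi> (x + y) = \<phi> x + \<phi> y" and scalar: "\<And>c. \<phi> (scalar c) = c"
    and le: "\<And>x. cmod (\<phi> x) \<le> norm x" and h: "star h = h" and one: "norm (1::'a) = 1"
  shows "Im (\<phi> h) = 0"
proof -
  have bound: "(Im (\<phi> h) + t)\<^sup>2 \<le> (norm h)\<^sup>2 + t\<^sup>2" for t :: real
  proof -
    let ?c = "\<i> * of_real t"
    let ?x = "h + scalar ?c"
    have "Im (\<phi> ?x) = Im (\<phi> h) + t" by (simp add: add scalar)
    then have "(Im (\<phi> h) + t)\<^sup>2 \<le> (cmod (\<phi> ?x))\<^sup>2"
      using cmod_power2[of "\<phi> ?x"] by simp
    also have "\<dots> \<le> (norm ?x)\<^sup>2" by (intro power_mono le) auto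
    also have "\<dots> = norm (star ?x * ?x)" by (simp add: cstar_identity)
    also have "star ?x * ?x = h * h + scalar (of_real (t\<^sup>2))"
    proof -
      have "star ?x * ?x = h * h + (scalar (-?c) + scalar ?c) * h + scalar (-?c) * scalar ?c"
        by (simp add: star_add star_scalar h algebra_simps)
      also have "scalar (-?c) * scalar ?c = (scalar (of_real (t\<^sup>2)) :: 'a)"
        unfolding scalar_mult[symmetric] by (rule arg_cong[of _ _ scalar]) (simp add: power2_eq_square complex_eq_iff)
      finally show ?thesis by (simp add: scalar_minus)
    qed
    also have "norm \<dots> \<le> norm (h * h) + norm (scalar (of_real (t\<^sup>2)) :: 'a)" by (rule norm_triangle_ineq)
    also have "\<dots> = (norm h)\<^sup>2 + t\<^sup>2" by (simp add: norm_square scalar_def norm_scaleC one norm_power)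
    finally show ?thesis .
  qed
  show ?thesis
  proof (rule ccontr)
    assume "Im (\<phi> h) \<noteq> 0"
    \<comment> \<open>This \<open>t\<close> makes the linear term cancel the squared norm, leaving the square of the imaginary part.\<close>
    then have "2 * Im (\<phi> h) * ((norm h)\<^sup>2 / (2 * Im (\<phi> h))) = (norm h)\<^sup>2" by simp
    then have "(Im (\<phi> h))\<^sup>2 \<le> 0"
      using bound[of "(norm h)\<^sup>2 / (2 * Im (\<phi> h))"] by (simp add: power2_sum)
    then show False using \<open>Im (\<phi> h) \<noteq> 0\<close> by simp
  qed
qed

text \<open>For a multiplicative seminorm \<open>q\<close> with \<open>q a = \<parallel>a\<parallel>\<close>, each \<open>x\<close> is at \<open>q\<close>-distance zero
  from exactly one scalar. That scalar depends multiplicatively and linearly on \<open>x\<close>, and its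
  absolute value is \<open>q x\<close>.\<close>

theorem character_attains_norm:
  assumes a: "(a::'a::comm_unital_cstar_algebra) \<noteq> 0"
  shows "\<exists>\<phi>. character \<phi> \<and> cmod (\<phi> a) = norm a"
proof -
  obtain q where q: "uniform_seminorm q" "q a = norm a" and qm: "\<And>x y. q (x * y) = q x * q y"
    using exists_multiplicative_seminorm[OF a] by blast
  interpret uniform_seminorm q by (rule q)
  obtain \<phi> where \<phi>: "\<And>x. q (x - scalar (\<phi> x)) = 0"
    using gelfand_mazur[OF qm] by metis
  have eq: "\<phi> x = c" if "q (x - scalar c) = 0" for x c
  proof -
    have "cmod (\<phi> x - c) = q ((x - scalar c) - (x - scalar (\<phi> x)))"
      by (simp add: scalar[symmetric] scalar_diff)
    also have "\<dots> \<le> 0" using diff_triangle[of "x - scalar c" "x - scalar (\<phi> x)"] that \<phi> by simp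
    finally show ?thesis by simp
  qed
  have null: "q x = 0" if "q x \<le> 0" for x using that nonneg[of x] by simp
  have add: "\<phi> (x + y) = \<phi> x + \<phi> y" for x y
    using triangle[of "x - scalar (\<phi> x)" "y - scalar (\<phi> y)"] \<phi>
    by (intro eq null) (simp add: scalar_add algebra_simps)
  have mult: "\<phi> (x * y) = \<phi> x * \<phi> y" for x y
  proof (intro eq null)
    have "x * y - scalar (\<phi> x * \<phi> y) = (x - scalar (\<phi> x)) * y + scalar (\<phi> x) * (y - scalar (\<phi> y))"
      by (simp add: scalar_mult algebra_simps)
    then show "q (x * y - scalar (\<phi> x * \<phi> y)) \<le> 0"
      using triangle[of "(x - scalar (\<phi> x)) * y" "scalar (\<phi> x) * (y - scalar (\<phi> y))"] \<phi>
      by (simp add: qm)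
  qed
  have sc: "\<phi> (scalar c) = c" for c by (intro eq) (simp add: zero)
  have val: "cmod (\<phi> x) = q x" for x
    using triangle[of "x - scalar (\<phi> x)" "scalar (\<phi> x)"] diff_ge[of "scalar (\<phi> x)" x]
      minus[of "x - scalar (\<phi> x)"] \<phi>[of x]
    by (simp add: scalar)
  have le: "cmod (\<phi> x) \<le> norm x" for x using val le_norm by simp
  have real: "Im (\<phi> h) = 0" if "star h = h" for h
    by (rule selfadjoint_multiplicative_functional_real[OF add sc le that norm_one_if_nonzero[OF a]])
  have star: "\<phi> (star x) = cnj (\<phi> x)" for x
  proof -
    have 1: "Im (\<phi> (x + star x)) = 0" by (rule real) (simp add: star_add star_star add.commute)
    have "Im (\<phi> (scalar \<i> * x + star (scalar \<i> * x))) = 0"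
      by (rule real) (simp add: star_add star_star add.commute)
    then have "Im (\<i> * \<phi> x - \<i> * \<phi> (star x)) = 0"
      by (simp add: add mult sc star_mult star_scalar mult.commute)
    with 1 show ?thesis by (simp add: add complex_eq_iff)
  qed
  have "character \<phi>"
    by standard (simp_all add: add mult star le scaleC_eq_scalar_mult sc)
  then show ?thesis using val q(2) by auto
qed


section \<open>Complete function spaces\<close>

lemma bounded_bilinear_scaleC:
  "bounded_bilinear (scaleC :: complex \<Rightarrow> 'a \<Rightarrow> 'a::comm_unital_cstar_algebra)"
proof (rule bounded_bilinear.intro)
  show "scaleC (r *\<^sub>R c) x = r *\<^sub>R scaleC c x" for r c and x :: 'a
    by (metis scaleC_of_real scaleC_scaleC scaleR_conv_of_real)
  show "scaleC c (r *\<^sub>R x) = r *\<^sub>R scaleC c x" for r c and x :: 'a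
    by (metis scaleC_of_real scaleC_scaleC mult.commute)
  show "\<exists>K. \<forall>c (x::'a). norm (scaleC c x) \<le> norm c * norm x * K"
    by (rule exI[of _ 1]) (simp add: norm_scaleC)
qed (simp_all add: scaleC_add_left scaleC_add_right)

lemma complex_vector_space_on_fun:
  "complex_vector_space_on (S \<rightarrow>\<^sub>E (UNIV :: 'a::comm_unital_cstar_algebra set))
     (fun_add S) (fun_zero S) (fun_scale S)"
proof
  show "fun_add S f (fun_zero S) = f" if "f \<in> S \<rightarrow>\<^sub>E UNIV" for f :: "_ \<Rightarrow> 'a"
    using that by (auto simp: fun_add_def fun_zero_def PiE_def extensional_def)
qed (auto simp: fun_add_def fun_zero_def fun_scale_def scaleC_one scaleC_minus_one scaleC_scaleC
    scaleC_add_left scaleC_add_right add.assoc add.commute intro!: restrict_ext dest: PiE_restrict)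

text \<open>All three topological requirements are checked one coordinate at a time. A Cauchy filter of functions projects
  to Cauchy filters in the Banach space \<open>A\<close>, whose limits assemble to a limit function.\<close>

lemma complete_tvs_on_fun:
  fixes S :: "'s set"
  shows "complete_tvs_on (S \<rightarrow>\<^sub>E (UNIV :: 'a::comm_unital_cstar_algebra set))
     (fun_add S) (fun_zero S) (fun_scale S) (fun_topology S)"
proof -
  let ?V = "S \<rightarrow>\<^sub>E (UNIV :: 'a set)" and ?T = "fun_topology S :: ('s \<Rightarrow> 'a) topology"
  interpret complex_vector_space_on ?V "fun_add S" "fun_zero S" "fun_scale S"
    by (rule complex_vector_space_on_fun)
  have top: "topspace ?T = ?V" by (simp add: fun_topology_def)
  have proj: "continuous_map ?T euclidean (\<lambda>f. f s)" if "s \<in> S" for s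
    using continuous_map_product_projection[OF that] by (simp add: fun_topology_def)
  show ?thesis
  proof
    show "topspace ?T = ?V" by (rule top)
    have "continuous_map (prod_topology ?T ?T) euclidean (\<lambda>q. fst q s + snd q s)" if "s \<in> S" for s
      using continuous_map_compose[OF continuous_map_fst proj[OF that], of ?T]
        continuous_map_compose[OF continuous_map_snd proj[OF that], of ?T]
      by (intro continuous_map_add) (simp_all add: o_def)
    then show "continuous_map (prod_topology ?T ?T) ?T (\<lambda>(x, y). fun_add S x y)"
      unfolding fun_topology_def[of S] continuous_map_componentwise
      by (auto simp: fun_add_def case_prod_beta fun_topology_def)
    let ?P = "prod_topology (euclidean :: complex topology) ?T"
    have "continuous_map ?P euclidean (\<lambda>q. scaleC (fst q) (snd q s))" if "s \<in> S" for s
    proof -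
      have "continuous_map ?P euclidean (\<lambda>q. snd q s)"
        using continuous_map_compose[OF continuous_map_snd proj[OF that], of euclidean]
        by (simp add: o_def)
      then show ?thesis
        using continuous_map_fst[of "euclidean :: complex topology" ?T]
        by (auto simp: continuous_map_atin intro: bounded_bilinear.tendsto[OF bounded_bilinear_scaleC])
    qed
    then show "continuous_map ?P ?T (\<lambda>(c, x). fun_scale S c x)"
      unfolding fun_topology_def[of S] continuous_map_componentwise
      by (auto simp: fun_scale_def case_prod_beta fun_topology_def)
    fix F :: "('s \<Rightarrow> 'a) filter"
    assume F: "F \<noteq> bot" "F \<le> principal ?V"
      and cauchy: "\<And>U. openin ?T U \<Longrightarrow> fun_zero S \<in> U \<Longrightarrow> \<forall>\<^sub>F (x, y) in F \<times>\<^sub>F F. diff x y \<in> U"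
    have "\<exists>l. ((\<lambda>f. f s) \<longlongrightarrow> l) F" if s: "s \<in> S" for s
    proof -
      have "cauchy_filter (filtermap (\<lambda>f. f s) F)"
        unfolding cauchy_filter_metric_filtermap
      proof (intro allI impI)
        fix e :: real assume "e > 0"
        define U where "U = {f \<in> topspace ?T. f s \<in> ball 0 e}"
        have "openin ?T U"
          unfolding U_def by (rule openin_continuous_map_preimage[OF proj[OF s]]) simp
        moreover have "fun_zero S \<in> U" using \<open>e > 0\<close> s by (simp add: U_def top fun_zero_def)
        ultimately obtain Q where "eventually Q F" and Q: "\<And>x y. Q x \<Longrightarrow> Q y \<Longrightarrow> diff x y \<in> U"
          using cauchy unfolding eventually_prod_same by fastforce
        moreover have "dist (x s) (y s) < e" if "Q x" "Q y" for x y
          using Q[OF that] s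
          by (simp add: U_def diff_def fun_add_def fun_scale_def scaleC_minus_one dist_norm)
        ultimately show "\<exists>P. eventually P F \<and> (\<forall>x y. P x \<and> P y \<longrightarrow> dist (x s) (y s) < e)" by blast
      qed
      then have "\<exists>l. filtermap (\<lambda>f. f s) F \<le> nhds l"
        by (rule cauchy_filter_complete_converges[OF _ complete_UNIV])
          (use F in \<open>auto simp: filtermap_bot_iff\<close>)
      then show ?thesis by (simp add: filterlim_def)
    qed
    then obtain l where l: "\<And>s. s \<in> S \<Longrightarrow> ((\<lambda>f. f s) \<longlongrightarrow> l s) F" by metis
    have "\<forall>\<^sub>F f in F. f \<in> ?V" using F(2) by (simp add: le_principal)
    then have "limitin ?T (\<lambda>f. f) (restrict l S) F"
      using l unfolding fun_topology_def limitin_componentwise by auto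
    then show "\<exists>l. limitin ?T (\<lambda>x. x) l F" by blast
  qed
qed

text \<open>A norm that lies between the largest entry and a multiple of the sum of the entries is, on a finite index set,
  complete and induces the product topology. Both facts are thus separated from the way the C*-norm is built.\<close>

locale entrywise_bounded_norm =
  fixes S :: "'s set" and nrm :: "('s \<Rightarrow> 'a::comm_unital_cstar_algebra) \<Rightarrow> real" and C :: real
  assumes finite: "finite S"
    and triangle: "\<lbrakk>f \<in> S \<rightarrow>\<^sub>E UNIV; g \<in> S \<rightarrow>\<^sub>E UNIV\<rbrakk> \<Longrightarrow> nrm (fun_add S f g) \<le> nrm f + nrm g"
    and scale: "f \<in> S \<rightarrow>\<^sub>E UNIV \<Longrightarrow> nrm (fun_scale S c f) = cmod c * nrm f"
    and lower: "\<lbrakk>f \<in> S \<rightarrow>\<^sub>E UNIV; s \<in> S\<rbrakk> \<Longrightarrow> norm (f s) \<le> nrm f"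
    and upper: "f \<in> S \<rightarrow>\<^sub>E UNIV \<Longrightarrow> nrm f \<le> C * (\<Sum>s\<in>S. norm (f s))"
begin

abbreviation "V \<equiv> S \<rightarrow>\<^sub>E (UNIV :: 'a set)"

sublocale complex_vector_space_on V "fun_add S" "fun_zero S" "fun_scale S"
  by (rule complex_vector_space_on_fun)

lemma diff_eq: "diff f g = (\<lambda>s\<in>S. f s - g s)"
  by (auto simp: diff_def fun_add_def fun_scale_def scaleC_minus_one)

lemma diff_closed: "diff f g \<in> V"
  by (simp add: diff_eq)

lemma nrm_zero: "nrm (fun_zero S) = 0"
proof -
  have "fun_scale S 0 (fun_zero S :: 's \<Rightarrow> 'a) = fun_zero S"
    by (auto simp: fun_scale_def fun_zero_def scaleC_zero_right)
  then show ?thesis using scale[OF zero_closed, of 0] by simp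
qed

lemma nrm_nonneg: assumes "f \<in> V" shows "0 \<le> nrm f"
  using triangle[OF assms scale_closed[OF assms, of "-1"]] scale[OF assms, of "-1"]
    add_inverse[OF assms] nrm_zero
  by simp

lemma nrm_eq_zero: assumes "f \<in> V" shows "nrm f = 0 \<longleftrightarrow> f = fun_zero S"
proof
  assume "nrm f = 0"
  then have "f s = 0" if "s \<in> S" for s using lower[OF assms that] by simp
  then show "f = fun_zero S" using assms by (auto simp: fun_zero_def PiE_def extensional_def)
qed (simp add: nrm_zero)

lemma nrm_diff_commute: "nrm (diff f g) = nrm (diff g f)"
proof -
  have "diff g f = fun_scale S (-1) (diff f g)"
    by (auto simp: diff_eq fun_scale_def scaleC_minus_one)
  then show ?thesis using scale[OF diff_closed, of "-1"] by simp
qed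

sublocale M: Metric_space V "norm_dist nrm"
proof
  fix f g h :: "'s \<Rightarrow> 'a"
  show "0 \<le> norm_dist nrm f g" by (simp add: norm_dist_def nrm_nonneg diff_closed)
  show "norm_dist nrm f g = norm_dist nrm g f" by (auto simp: norm_dist_def nrm_diff_commute)
  show "norm_dist nrm f g = 0 \<longleftrightarrow> f = g" if "f \<in> V" "g \<in> V"
  proof -
    have "diff f g = fun_zero S \<longleftrightarrow> (\<forall>s\<in>S. f s = g s)"
      by (auto simp: diff_eq fun_zero_def restrict_def fun_eq_iff)
    also have "\<dots> \<longleftrightarrow> f = g" using that by (metis PiE_ext)
    finally show ?thesis using that by (simp add: norm_dist_def nrm_eq_zero diff_closed)
  qed
  show "norm_dist nrm f h \<le> norm_dist nrm f g + norm_dist nrm g h"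
    if "f \<in> V" "g \<in> V" "h \<in> V"
  proof -
    have "diff f h = fun_add S (diff f g) (diff g h)"
      by (auto simp: diff_eq fun_add_def)
    then show ?thesis using that triangle[OF diff_closed diff_closed] by (simp add: norm_dist_def)
  qed
qed

lemma dist_entry_le: "\<lbrakk>f \<in> V; g \<in> V; s \<in> S\<rbrakk> \<Longrightarrow> dist (f s) (g s) \<le> norm_dist nrm f g"
  using lower[OF diff_closed, of s f g] by (simp add: norm_dist_def diff_eq dist_norm)

lemma dist_le_entries:
  "\<lbrakk>f \<in> V; g \<in> V\<rbrakk> \<Longrightarrow> norm_dist nrm f g \<le> C * (\<Sum>s\<in>S. dist (f s) (g s))"
  using upper[OF diff_closed, of f g] by (simp add: norm_dist_def diff_eq dist_norm)

lemma mtopology_eq: "M.mtopology = fun_topology S"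
proof (rule topology_eq[THEN iffD2], intro allI iffI)
  fix U :: "('s \<Rightarrow> 'a) set"
  assume "openin (fun_topology S) U"
  have "continuous_map M.mtopology euclidean (\<lambda>f. f s)" if s: "s \<in> S" for s
  proof (unfold continuous_map_def, intro conjI allI impI)
    fix W :: "'a set" assume "openin euclidean W"
    then have W: "open W" by simp
    show "openin M.mtopology {f \<in> topspace M.mtopology. f s \<in> W}"
      unfolding M.openin_mtopology
    proof (intro conjI allI impI)
      fix f assume f: "f \<in> {f \<in> topspace M.mtopology. f s \<in> W}"
      then obtain e where "e > 0" "ball (f s) e \<subseteq> W" using W open_contains_ball by blast
      moreover have "g s \<in> ball (f s) e" if "g \<in> M.mball f e" for g
        using that dist_entry_le[OF _ _ s, of f g] by (simp add: M.mball_def)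
      ultimately show "\<exists>r>0. M.mball f r \<subseteq> {f \<in> topspace M.mtopology. f s \<in> W}"
        by (intro exI[of _ e]) (auto simp: M.mball_def)
    qed auto
  qed auto
  then have "continuous_map M.mtopology (fun_topology S) (\<lambda>f. f)"
    unfolding fun_topology_def continuous_map_componentwise M.topspace_mtopology
    by (auto simp: PiE_def)
  then have "openin M.mtopology {f \<in> topspace M.mtopology. f \<in> U}"
    using \<open>openin (fun_topology S) U\<close> by (rule openin_continuous_map_preimage)
  moreover have "U \<subseteq> V" using openin_subset[OF \<open>openin (fun_topology S) U\<close>] by (simp add: fun_topology_def)
  ultimately show "openin M.mtopology U" by (simp add: Collect_conj_eq Int_absorb1 Int_absorb2)
next
  fix U :: "('s \<Rightarrow> 'a) set"
  assume U: "openin M.mtopology U"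
  show "openin (fun_topology S) U"
  proof (rule openin_subopen[THEN iffD2], intro ballI)
    fix f assume f: "f \<in> U"
    then obtain r where r: "r > 0" "M.mball f r \<subseteq> U" using U M.openin_mtopology by blast
    have fV: "f \<in> V" using U f M.openin_mtopology by blast
    \<comment> \<open>Adding 1 to both factors keeps the radius defined when \<open>C\<close> is zero or \<open>S\<close> is empty.\<close>
    define e where "e = r / ((\<bar>C\<bar> + 1) * (real (card S) + 1))"
    have e: "e > 0" using r by (simp add: e_def)
    define W where "W = (\<Pi>\<^sub>E s\<in>S. ball (f s) e)"
    have "openin (fun_topology S) W"
      unfolding W_def fun_topology_def openin_PiE_gen using finite by auto
    moreover have "f \<in> W" using fV e by (auto simp: W_def PiE_def)
    moreover have "W \<subseteq> U"
    proof
      fix g assume g: "g \<in> W"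
      then have gV: "g \<in> V" by (auto simp: W_def PiE_def)
      have "(\<Sum>s\<in>S. dist (f s) (g s)) \<le> (\<Sum>s\<in>S. e)"
        using g by (intro sum_mono) (auto simp: W_def PiE_def Pi_def less_imp_le)
      then have "(\<Sum>s\<in>S. dist (f s) (g s)) \<le> card S * e" by simp
      have "norm_dist nrm f g \<le> C * (\<Sum>s\<in>S. dist (f s) (g s))" by (rule dist_le_entries[OF fV gV])
      also have "\<dots> \<le> \<bar>C\<bar> * (\<Sum>s\<in>S. dist (f s) (g s))"
        by (intro mult_right_mono) (auto simp: sum_nonneg)
      also have "\<dots> \<le> \<bar>C\<bar> * (card S * e)" using \<open>(\<Sum>s\<in>S. dist (f s) (g s)) \<le> card S * e\<close> by (intro mult_left_mono) auto
      also have "\<dots> < (\<bar>C\<bar> + 1) * ((real (card S) + 1) * e)"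
        by (rule mult_strict_mono) (use e in auto)
      also have "\<dots> = r" by (simp add: e_def add_nonneg_eq_0_iff)
      finally show "g \<in> U" using r fV gV by (auto simp: M.mball_def)
    qed
    ultimately show "\<exists>W. openin (fun_topology S) W \<and> f \<in> W \<and> W \<subseteq> U" by blast
  qed
qed

lemma mcomplete: "M.mcomplete"
  unfolding M.mcomplete_def
proof (intro allI impI)
  fix \<sigma> assume \<sigma>: "M.MCauchy \<sigma>"
  then have V: "\<sigma> n \<in> V" for n by (auto simp: M.MCauchy_def)
  have "\<exists>l. (\<lambda>n. \<sigma> n s) \<longlonglongrightarrow> l" if s: "s \<in> S" for s
  proof -
    have "Cauchy (\<lambda>n. \<sigma> n s)"
      unfolding Cauchy_def
      by (meson M.MCauchy_def \<sigma> V dist_entry_le[OF _ _ s] le_less_trans)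
    then show ?thesis using Cauchy_convergent by (auto simp: convergent_def)
  qed
  then obtain l where "\<And>s. s \<in> S \<Longrightarrow> (\<lambda>n. \<sigma> n s) \<longlonglongrightarrow> l s" by metis
  then have "limitin (fun_topology S) \<sigma> (restrict l S) sequentially"
    using V unfolding fun_topology_def limitin_componentwise by auto
  then show "\<exists>x. limitin M.mtopology \<sigma> x sequentially" unfolding mtopology_eq by blast
qed

end


section \<open>Convolution algebras of finite groupoids\<close>

lemma star_sum: "star (sum f A) = (\<Sum>x\<in>A. star (f x :: 'a::comm_unital_cstar_algebra))"
  by (induction A rule: infinite_finite_induct) (auto simp: star_zero star_add)

lemma scaleC_sum: "scaleC c (sum f A) = (\<Sum>x\<in>A. scaleC c (f x :: 'a::comm_unital_cstar_algebra))"
  by (simp add: scaleC_eq_scalar_mult sum_distrib_left)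

text \<open>The axioms avoid naming the units: an identity arrow enters only as \<open>comp x (inv x)\<close>, and
  the inverse acts by cancellation.\<close>

locale finite_groupoid =
  fixes G :: "'g set"
    and composable :: "'g \<Rightarrow> 'g \<Rightarrow> bool"
    and comp :: "'g \<Rightarrow> 'g \<Rightarrow> 'g"
    and inv :: "'g \<Rightarrow> 'g"
  assumes finite_G: "finite G"
    and comp_closed: "\<lbrakk>x \<in> G; y \<in> G; composable x y\<rbrakk> \<Longrightarrow> comp x y \<in> G"
    and inv_closed: "x \<in> G \<Longrightarrow> inv x \<in> G"
    and inv_inv: "x \<in> G \<Longrightarrow> inv (inv x) = x"
    and composable_assoc: "\<lbrakk>x \<in> G; y \<in> G; z \<in> G\<rbrakk> \<Longrightarrow>
      composable x y \<and> composable (comp x y) z \<longleftrightarrow> composable y z \<and> composable x (comp y z)"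
    and comp_assoc: "\<lbrakk>x \<in> G; y \<in> G; z \<in> G; composable x y; composable (comp x y) z\<rbrakk> \<Longrightarrow>
      comp (comp x y) z = comp x (comp y z)"
    and composable_inv: "x \<in> G \<Longrightarrow> composable x (inv x)"
    and composable_inv_comp: "\<lbrakk>x \<in> G; y \<in> G; composable x y\<rbrakk> \<Longrightarrow> composable (inv x) (comp x y)"
    and inv_comp_cancel: "\<lbrakk>x \<in> G; y \<in> G; composable x y\<rbrakk> \<Longrightarrow> comp (inv x) (comp x y) = y"
    and composable_inv_inv: "\<lbrakk>x \<in> G; y \<in> G; composable x y\<rbrakk> \<Longrightarrow> composable (inv y) (inv x)"
    and inv_comp: "\<lbrakk>x \<in> G; y \<in> G; composable x y\<rbrakk> \<Longrightarrow> inv (comp x y) = comp (inv y) (inv x)"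
begin

definition factorizations :: "'g \<Rightarrow> ('g \<times> 'g) set" where
  "factorizations z = {(x, y). x \<in> G \<and> y \<in> G \<and> composable x y \<and> comp x y = z}"

definition conv ::
  "('g \<Rightarrow> 'a::comm_unital_cstar_algebra) \<Rightarrow> ('g \<Rightarrow> 'a) \<Rightarrow> 'g \<Rightarrow> 'a" where
  "conv f g = (\<lambda>z\<in>G. \<Sum>(x, y)\<in>factorizations z. f x * g y)"

definition adj :: "('g \<Rightarrow> 'a::comm_unital_cstar_algebra) \<Rightarrow> 'g \<Rightarrow> 'a" where
  "adj f = (\<lambda>z\<in>G. star (f (inv z)))"

lemma finite_factorizations: "finite (factorizations z)"
  by (rule finite_subset[of _ "G \<times> G"]) (auto simp: factorizations_def finite_G)

lemma regroup_right:
  "\<lbrakk>(w, z) \<in> factorizations t; (x, y) \<in> factorizations w\<rbrakk> \<Longrightarrow>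
     (x, comp y z) \<in> factorizations t \<and> (y, z) \<in> factorizations (comp y z) \<and> comp x y = w"
  using composable_assoc[of x y z] comp_assoc[of x y z] by (auto simp: factorizations_def comp_closed)

lemma regroup_left:
  "\<lbrakk>(x, w) \<in> factorizations t; (y, z) \<in> factorizations w\<rbrakk> \<Longrightarrow>
     (comp x y, z) \<in> factorizations t \<and> (x, y) \<in> factorizations (comp x y) \<and> comp y z = w"
  using composable_assoc[of x y z] comp_assoc[of x y z] by (auto simp: factorizations_def comp_closed)

lemma conv_closed: "conv f g \<in> G \<rightarrow>\<^sub>E UNIV"
  by (simp add: conv_def)

lemma adj_closed: "adj f \<in> G \<rightarrow>\<^sub>E UNIV"
  by (simp add: adj_def)

lemma conv_cong:
  assumes "\<And>x. x \<in> G \<Longrightarrow> f x = f' x" "\<And>x. x \<in> G \<Longrightarrow> g x = g' x"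
  shows "conv f g = conv f' g'"
  unfolding conv_def
  by (intro restrict_ext sum.cong refl) (auto simp: factorizations_def assms)

text \<open>Both sides sum over the factorizations of \<open>t\<close> into three arrows, bracketed in the two ways.\<close>

lemma conv_assoc: "conv (conv f g) h = conv f (conv g h)"
proof
  fix t
  show "conv (conv f g) h t = conv f (conv g h) t"
  proof (cases "t \<in> G")
    case True
    have "conv (conv f g) h t = (\<Sum>p\<in>factorizations t. (\<Sum>q\<in>factorizations (fst p). f (fst q) * g (snd q)) * h (snd p))"
      using True by (auto simp: conv_def case_prod_beta factorizations_def intro!: sum.cong)
    also have "\<dots> = (\<Sum>(p, q)\<in>(SIGMA p:factorizations t. factorizations (fst p)). f (fst q) * g (snd q) * h (snd p))"
      by (subst sum.Sigma[symmetric]) (auto simp: finite_factorizations sum_distrib_right)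
    also have "\<dots> = (\<Sum>(p, q)\<in>(SIGMA p:factorizations t. factorizations (snd p)). f (fst p) * (g (fst q) * h (snd q)))"
      by (rule sum.reindex_bij_witness[where
          j = "\<lambda>((w, z), (x, y)). ((x, comp y z), (y, z))" and
          i = "\<lambda>((x, w), (y, z)). ((comp x y, z), (x, y))"])
        (auto simp: mult.assoc dest: regroup_right regroup_left)
    also have "\<dots> = (\<Sum>p\<in>factorizations t. f (fst p) * (\<Sum>q\<in>factorizations (snd p). g (fst q) * h (snd q)))"
      by (subst sum.Sigma[symmetric]) (auto simp: finite_factorizations sum_distrib_left)
    also have "\<dots> = conv f (conv g h) t"
      using True by (auto simp: conv_def case_prod_beta factorizations_def intro!: sum.cong)
    finally show ?thesis .
  qed (simp add: conv_def)
qed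

lemma conv_add_left: "conv (fun_add G f g) h = fun_add G (conv f h) (conv g h)"
  unfolding conv_def fun_add_def
  by (intro restrict_ext)
    (auto simp: factorizations_def distrib_right sum.distrib[symmetric] intro!: sum.cong)

lemma conv_add_right: "conv h (fun_add G f g) = fun_add G (conv h f) (conv h g)"
  unfolding conv_def fun_add_def
  by (intro restrict_ext)
    (auto simp: factorizations_def distrib_left sum.distrib[symmetric] intro!: sum.cong)

lemma conv_scale_left: "conv (fun_scale G c f) g = fun_scale G c (conv f g)"
  unfolding conv_def fun_scale_def
  by (intro restrict_ext)
    (auto simp: factorizations_def scaleC_sum mult_scaleC_left intro!: sum.cong)

lemma conv_scale_right: "conv f (fun_scale G c g) = fun_scale G c (conv f g)"
  unfolding conv_def fun_scale_def
  by (intro restrict_ext)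
    (auto simp: factorizations_def scaleC_eq_scalar_mult sum_distrib_left mult.left_commute intro!: sum.cong)

lemma adj_adj: "f \<in> G \<rightarrow>\<^sub>E UNIV \<Longrightarrow> adj (adj f) = f"
  by (auto simp: adj_def fun_eq_iff restrict_def inv_closed inv_inv star_star PiE_def extensional_def)

lemma adj_add: "adj (fun_add G f g) = fun_add G (adj f) (adj g)"
  by (auto simp: adj_def fun_add_def fun_eq_iff restrict_def inv_closed star_add)

lemma adj_scale: "adj (fun_scale G c f) = fun_scale G (cnj c) (adj f)"
  by (auto simp: adj_def fun_scale_def fun_eq_iff restrict_def inv_closed star_scaleC)

lemma adj_conv: "adj (conv f g) = conv (adj g) (adj f)"
proof
  fix z
  show "adj (conv f g) z = conv (adj g) (adj f) z"
  proof (cases "z \<in> G")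
    case True
    have "adj (conv f g) z = (\<Sum>(x, y)\<in>factorizations (inv z). star (g y) * star (f x))"
      using True by (auto simp: adj_def conv_def inv_closed star_sum star_mult intro!: sum.cong)
    also have "\<dots> = (\<Sum>(x, y)\<in>factorizations z. star (g (inv x)) * star (f (inv y)))"
      by (rule sum.reindex_bij_witness[where j = "\<lambda>(x, y). (inv y, inv x)" and i = "\<lambda>(x, y). (inv y, inv x)"])
        (use True in \<open>auto simp: factorizations_def inv_closed inv_inv composable_inv_inv inv_comp[symmetric]\<close>)
    also have "\<dots> = conv (adj g) (adj f) z"
      using True by (auto simp: adj_def conv_def factorizations_def intro!: sum.cong)
    finally show ?thesis .
  qed (simp add: adj_def conv_def)
qed

definition inner :: "('g \<Rightarrow> complex) \<Rightarrow> ('g \<Rightarrow> complex) \<Rightarrow> complex" where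
  "inner v w = (\<Sum>z\<in>G. cnj (v z) * w z)"

definition l2norm :: "('g \<Rightarrow> complex) \<Rightarrow> real" where
  "l2norm v = L2_set (\<lambda>z. cmod (v z)) G"

lemma l2norm_nonneg: "0 \<le> l2norm v"
  by (simp add: l2norm_def)

lemma inner_self: "inner v v = of_real ((l2norm v)\<^sup>2)"
  by (simp add: inner_def l2norm_def L2_set_def sum_nonneg complex_norm_square mult.commute
      del: of_real_power)

lemma cauchy_schwarz: "cmod (inner v w) \<le> l2norm v * l2norm w"
proof -
  have "cmod (inner v w) \<le> (\<Sum>z\<in>G. \<bar>cmod (v z)\<bar> * \<bar>cmod (w z)\<bar>)"
    unfolding inner_def by (rule order_trans[OF norm_sum]) (simp add: norm_mult)
  also have "\<dots> \<le> l2norm v * l2norm w"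
    unfolding l2norm_def by (rule L2_set_mult_ineq)
  finally show ?thesis .
qed

text \<open>The triples \<open>(x, y, z)\<close> with \<open>x y = z\<close> are the same as those with \<open>x\<^sup>-\<^sup>1 z = y\<close>: the regular
  representation carries the groupoid involution to the Hilbert space adjoint.\<close>

lemma inner_conv: "inner (conv f v) w = inner v (conv (adj f) w)"
proof -
  have "inner (conv f v) w = (\<Sum>z\<in>G. \<Sum>q\<in>factorizations z. cnj (f (fst q)) * cnj (v (snd q)) * w z)"
    by (simp add: inner_def conv_def case_prod_beta sum_distrib_right)
  also have "\<dots> = (\<Sum>(z, q)\<in>(SIGMA z:G. factorizations z). cnj (f (fst q)) * cnj (v (snd q)) * w z)"
    by (rule sum.Sigma) (auto simp: finite_G finite_factorizations)
  also have "\<dots> = (\<Sum>(y, q)\<in>(SIGMA y:G. factorizations y). cnj (v y) * (cnj (f (inv (fst q))) * w (snd q)))"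
    by (rule sum.reindex_bij_witness[where
          j = "\<lambda>(z, (x, y)). (y, (inv x, z))" and i = "\<lambda>(y, (x, z)). (z, (inv x, y))"])
      (auto simp: factorizations_def inv_closed inv_inv composable_inv_comp inv_comp_cancel comp_closed)
  also have "\<dots> = (\<Sum>y\<in>G. \<Sum>q\<in>factorizations y. cnj (v y) * (cnj (f (inv (fst q))) * w (snd q)))"
    by (rule sum.Sigma[symmetric]) (auto simp: finite_G finite_factorizations)
  also have "\<dots> = inner v (conv (adj f) w)"
    by (auto simp: inner_def conv_def case_prod_beta sum_distrib_left adj_def factorizations_def
        star_complex_def intro!: sum.cong)
  finally show ?thesis .
qed

text \<open>A crude bound, whose sole purpose is that the operator norm is finite and controlled by the entries. Cancellation
  makes the second factor of \<open>z\<close> a function of the first, so every entry of \<open>f\<close> occurs at most once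
  in the sum at \<open>z\<close>.\<close>

lemma l2norm_conv_le: "l2norm (conv f v) \<le> real (card G) * (\<Sum>x\<in>G. cmod (f x)) * l2norm v"
proof -
  have "cmod (conv f v z) \<le> (\<Sum>x\<in>G. cmod (f x)) * l2norm v" if z: "z \<in> G" for z
  proof -
    have "cmod (conv f v z) \<le> (\<Sum>q\<in>factorizations z. cmod (f (fst q)) * cmod (v (snd q)))"
      using z by (auto simp: conv_def case_prod_beta norm_mult intro!: order_trans[OF norm_sum])
    also have "\<dots> \<le> (\<Sum>q\<in>factorizations z. cmod (f (fst q)) * l2norm v)"
      unfolding l2norm_def
      by (intro sum_mono mult_left_mono member_le_L2_set finite_G) (auto simp: factorizations_def)
    also have "\<dots> = (\<Sum>x\<in>fst ` factorizations z. cmod (f x) * l2norm v)"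
    proof -
      have "inj_on fst (factorizations z)"
        by (rule inj_onI) (auto simp: factorizations_def, metis inv_comp_cancel)
      then show ?thesis by (simp add: sum.reindex)
    qed
    also have "\<dots> \<le> (\<Sum>x\<in>G. cmod (f x) * l2norm v)"
      by (rule sum_mono2) (auto simp: finite_G factorizations_def l2norm_nonneg)
    finally show ?thesis by (simp add: sum_distrib_right)
  qed
  then have "(\<Sum>z\<in>G. cmod (conv f v z)) \<le> (\<Sum>z\<in>G. (\<Sum>x\<in>G. cmod (f x)) * l2norm v)"
    by (rule sum_mono)
  then show ?thesis
    using L2_set_le_sum[of G "\<lambda>z. cmod (conv f v z)"] by (simp add: l2norm_def mult.assoc)
qed

lemma l2norm_add_le: "l2norm (fun_add G v w) \<le> l2norm v + l2norm w"
proof -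
  have "l2norm (fun_add G v w) \<le> L2_set (\<lambda>z. cmod (v z) + cmod (w z)) G"
    unfolding l2norm_def by (rule L2_set_mono) (auto simp: fun_add_def norm_triangle_ineq)
  also have "\<dots> \<le> l2norm v + l2norm w" unfolding l2norm_def by (rule L2_set_triangle_ineq)
  finally show ?thesis .
qed

lemma l2norm_scale: "l2norm (fun_scale G c v) = cmod c * l2norm v"
  by (simp add: l2norm_def fun_scale_def L2_set_right_distrib scaleC_complex_def norm_mult
      cong: L2_set_cong)

text \<open>The infimum of these common bounds is the supremum of the operator norms of all \<open>\<phi> \<circ> f\<close>. Stating
  them as homogeneous inequalities, with \<open>v\<close> not normalized, lets the norm properties be derived directly.\<close>

definition bounds :: "('g \<Rightarrow> 'a::comm_unital_cstar_algebra) \<Rightarrow> real set" where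
  "bounds f = {C. 0 \<le> C \<and> (\<forall>\<phi> v. character \<phi> \<longrightarrow> l2norm (conv (\<phi> \<circ> f) v) \<le> C * l2norm v)}"

definition op_norm :: "('g \<Rightarrow> 'a::comm_unital_cstar_algebra) \<Rightarrow> real" where
  "op_norm f = Inf (bounds f)"

lemma card_sum_in_bounds: "real (card G) * (\<Sum>x\<in>G. norm (f x)) \<in> bounds f"
proof -
  have "l2norm (conv (\<phi> \<circ> f) v) \<le> real (card G) * (\<Sum>x\<in>G. norm (f x)) * l2norm v"
    if "character \<phi>" for \<phi> v
  proof -
    have "l2norm (conv (\<phi> \<circ> f) v) \<le> real (card G) * (\<Sum>x\<in>G. cmod ((\<phi> \<circ> f) x)) * l2norm v"
      by (rule l2norm_conv_le)
    also have "\<dots> \<le> real (card G) * (\<Sum>x\<in>G. norm (f x)) * l2norm v"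
      using character.norm_le[OF that]
      by (intro mult_right_mono mult_left_mono sum_mono) (auto simp: l2norm_nonneg)
    finally show ?thesis .
  qed
  then show ?thesis by (auto simp: bounds_def sum_nonneg)
qed

lemma op_norm_least: "C \<in> bounds f \<Longrightarrow> op_norm f \<le> C"
  unfolding op_norm_def by (rule cInf_lower) (auto simp: bounds_def intro!: bdd_belowI[of _ 0])

lemma op_norm_nonneg: "0 \<le> op_norm f"
  unfolding op_norm_def using card_sum_in_bounds[of f]
  by (intro cInf_greatest) (auto simp: bounds_def)

lemma l2norm_conv_le_op_norm:
  assumes "character \<phi>"
  shows "l2norm (conv (\<phi> \<circ> f) v) \<le> op_norm f * l2norm v"
proof (cases "l2norm v = 0")
  case True
  then show ?thesis using card_sum_in_bounds[of f] assms by (auto simp: bounds_def) (metis mult_zero_right)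
next
  case False
  then have v: "l2norm v > 0" using l2norm_nonneg[of v] by simp
  have "l2norm (conv (\<phi> \<circ> f) v) / l2norm v \<le> op_norm f"
    unfolding op_norm_def
  proof (rule cInf_greatest)
    fix C assume "C \<in> bounds f"
    then show "l2norm (conv (\<phi> \<circ> f) v) / l2norm v \<le> C"
      using assms v by (simp add: bounds_def divide_le_eq)
  qed (use card_sum_in_bounds[of f] in auto)
  then show ?thesis using v by (simp add: divide_le_eq)
qed

lemma op_norm_leI:
  "\<lbrakk>0 \<le> C; \<And>\<phi> v. character \<phi> \<Longrightarrow> l2norm (conv (\<phi> \<circ> f) v) \<le> C * l2norm v\<rbrakk> \<Longrightarrow> op_norm f \<le> C"
  by (rule op_norm_least) (simp add: bounds_def)

lemma character_conv:
  assumes "character \<phi>" shows "conv (\<phi> \<circ> conv f g) v = conv (conv (\<phi> \<circ> f) (\<phi> \<circ> g)) v"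
proof -
  interpret character \<phi> by fact
  show ?thesis by (rule conv_cong) (auto simp: conv_def sum case_prod_beta mult)
qed

lemma character_adj:
  assumes "character \<phi>" shows "conv (\<phi> \<circ> adj f) v = conv (adj (\<phi> \<circ> f)) v"
proof -
  interpret character \<phi> by fact
  show ?thesis by (rule conv_cong) (auto simp: adj_def star star_complex_def)
qed

text \<open>Convolving with the point mass at \<open>x\<^sup>-\<^sup>1\<close> moves the entry at \<open>x\<close> to the arrow \<open>x x\<^sup>-\<^sup>1\<close>, by right
  cancellation without any other contribution there. A character that attains the norm of this entry then
  exhibits it as a lower bound of the operator norm.\<close>

lemma norm_entry_le_op_norm:
  assumes x: "x \<in> G" shows "norm (f x) \<le> op_norm f"
proof (cases "f x = 0")
  case True
  then show ?thesis by (simp add: op_norm_nonneg)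
next
  case False
  then obtain \<phi> where \<phi>: "character \<phi>" "cmod (\<phi> (f x)) = norm (f x)"
    using character_attains_norm by blast
  define v where "v z = (if z = inv x then 1 else 0 :: complex)" for z
  have "(l2norm v)\<^sup>2 = (\<Sum>z\<in>G. if z = inv x then 1 else 0)"
    by (auto simp: l2norm_def L2_set_def sum_nonneg v_def intro!: sum.cong)
  then have "(l2norm v)\<^sup>2 = 1" using x by (simp add: finite_G inv_closed)
  then have v: "l2norm v = 1" using l2norm_nonneg[of v] by (simp add: power2_eq_1_iff)
  define z where "z = comp x (inv x)"
  have z: "z \<in> G" using x by (simp add: z_def comp_closed inv_closed composable_inv)
  have fact: "(x, inv x) \<in> factorizations z"
    using x by (simp add: factorizations_def z_def inv_closed composable_inv)
  have "a = x" if "(a, inv x) \<in> factorizations z" for a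
  proof -
    have a: "a \<in> G" "composable a (inv x)" "comp a (inv x) = comp x (inv x)"
      using that by (auto simp: factorizations_def z_def)
    have "comp (inv (inv x)) (inv a) = comp (inv (inv x)) (inv x)"
      using a x inv_comp[of a "inv x"] inv_comp[of x "inv x"] by (simp add: inv_closed composable_inv)
    then have "inv a = inv x"
      using a x inv_comp_cancel composable_inv_inv by (metis composable_inv inv_closed)
    then show ?thesis using a x inv_inv by metis
  qed
  then have "conv (\<phi> \<circ> f) v z = (\<Sum>q\<in>factorizations z. if q = (x, inv x) then \<phi> (f x) else 0)"
    using z by (auto simp: conv_def v_def intro!: sum.cong)
  also have "\<dots> = \<phi> (f x)" using fact by (simp add: finite_factorizations)
  finally have "norm (f x) \<le> l2norm (conv (\<phi> \<circ> f) v)"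
    using member_le_L2_set[OF finite_G z, of "\<lambda>z. cmod (conv (\<phi> \<circ> f) v z)"] \<phi>(2)
    by (simp add: l2norm_def)
  also have "\<dots> \<le> op_norm f" using l2norm_conv_le_op_norm[OF \<phi>(1), of f v] v by simp
  finally show ?thesis .
qed

lemma op_norm_add: "op_norm (fun_add G f g) \<le> op_norm f + op_norm g"
proof (rule op_norm_leI)
  fix \<phi> :: "'a \<Rightarrow> complex" and v assume \<phi>: "character \<phi>"
  have "conv (\<phi> \<circ> fun_add G f g) v = conv (fun_add G (\<phi> \<circ> f) (\<phi> \<circ> g)) v"
    by (rule conv_cong) (auto simp: fun_add_def character.add[OF \<phi>])
  then have "l2norm (conv (\<phi> \<circ> fun_add G f g) v) \<le> l2norm (conv (\<phi> \<circ> f) v) + l2norm (conv (\<phi> \<circ> g) v)"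
    by (simp add: conv_add_left l2norm_add_le)
  then show "l2norm (conv (\<phi> \<circ> fun_add G f g) v) \<le> (op_norm f + op_norm g) * l2norm v"
    using l2norm_conv_le_op_norm[OF \<phi>, of f v] l2norm_conv_le_op_norm[OF \<phi>, of g v]
    by (simp add: distrib_right)
qed (simp add: op_norm_nonneg)

lemma op_norm_scale_le: "op_norm (fun_scale G c f) \<le> cmod c * op_norm f"
proof (rule op_norm_leI)
  fix \<phi> :: "'a \<Rightarrow> complex" and v assume \<phi>: "character \<phi>"
  have "conv (\<phi> \<circ> fun_scale G c f) v = conv (fun_scale G c (\<phi> \<circ> f)) v"
    by (rule conv_cong) (auto simp: fun_scale_def character.scaleC[OF \<phi>] scaleC_complex_def)
  then show "l2norm (conv (\<phi> \<circ> fun_scale G c f) v) \<le> cmod c * op_norm f * l2norm v"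
    using mult_left_mono[OF l2norm_conv_le_op_norm[OF \<phi>, of f v], of "cmod c"]
    by (simp add: conv_scale_left l2norm_scale mult.assoc)
qed (simp add: op_norm_nonneg)

lemma op_norm_scale: 
  assumes f: "f \<in> G \<rightarrow>\<^sub>E UNIV"
  shows "op_norm (fun_scale G c f) = cmod c * op_norm f"
proof (cases "c = 0")
  case True
  then show ?thesis
    using op_norm_scale_le[of 0 f] op_norm_nonneg[of "fun_scale G 0 f"] by simp
next
  case False
  have "f = fun_scale G (inverse c) (fun_scale G c f)"
    using f False by (auto simp: fun_scale_def fun_eq_iff scaleC_scaleC scaleC_one PiE_def extensional_def)
  then have "op_norm f \<le> cmod (inverse c) * op_norm (fun_scale G c f)"
    using op_norm_scale_le by metis
  then have "cmod c * op_norm f \<le> cmod c * (cmod (inverse c) * op_norm (fun_scale G c f))"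
    by (rule mult_left_mono) simp
  also have "\<dots> = op_norm (fun_scale G c f)" using False by (simp add: norm_inverse)
  finally have "cmod c * op_norm f \<le> op_norm (fun_scale G c f)" .
  then show ?thesis using op_norm_scale_le[of c f] by simp
qed

lemma op_norm_conv: "op_norm (conv f g) \<le> op_norm f * op_norm g"
proof (rule op_norm_leI)
  fix \<phi> :: "'a \<Rightarrow> complex" and v assume \<phi>: "character \<phi>"
  have "l2norm (conv (\<phi> \<circ> conv f g) v) = l2norm (conv (\<phi> \<circ> f) (conv (\<phi> \<circ> g) v))"
    by (simp add: character_conv[OF \<phi>] conv_assoc)
  also have "\<dots> \<le> op_norm f * l2norm (conv (\<phi> \<circ> g) v)" by (rule l2norm_conv_le_op_norm[OF \<phi>])
  also have "\<dots> \<le> op_norm f * (op_norm g * l2norm v)"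
    by (intro mult_left_mono l2norm_conv_le_op_norm \<phi> op_norm_nonneg)
  finally show "l2norm (conv (\<phi> \<circ> conv f g) v) \<le> op_norm f * op_norm g * l2norm v"
    by (simp add: mult.assoc)
qed (simp add: op_norm_nonneg)

text \<open>The Hilbert space computation \<open>\<parallel>f v\<parallel>\<^sup>2 = \<langle>v, f\<^sup>* f v\<rangle> \<le> \<parallel>f\<^sup>* f\<parallel> \<parallel>v\<parallel>\<^sup>2\<close>, for every character.\<close>

lemma op_norm_square_le: "(op_norm f)\<^sup>2 \<le> op_norm (conv (adj f) f)"
proof -
  let ?r = "op_norm (conv (adj f) f)"
  have "op_norm f \<le> sqrt ?r"
  proof (rule op_norm_leI)
    fix \<phi> :: "'a \<Rightarrow> complex" and v assume \<phi>: "character \<phi>"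
    let ?u = "conv (\<phi> \<circ> f) v"
    have "conv (\<phi> \<circ> conv (adj f) f) v = conv (\<phi> \<circ> adj f) ?u"
      by (simp only: character_conv[OF \<phi>] conv_assoc)
    then have "conv (adj (\<phi> \<circ> f)) ?u = conv (\<phi> \<circ> conv (adj f) f) v"
      by (simp only: character_adj[OF \<phi>])
    then have "inner ?u ?u = inner v (conv (\<phi> \<circ> conv (adj f) f) v)"
      by (simp only: inner_conv)
    then have "cmod (of_real ((l2norm ?u)\<^sup>2)) \<le> l2norm v * l2norm (conv (\<phi> \<circ> conv (adj f) f) v)"
      by (simp only: inner_self cauchy_schwarz)
    then have "(l2norm ?u)\<^sup>2 \<le> l2norm v * l2norm (conv (\<phi> \<circ> conv (adj f) f) v)"
      by (simp only: norm_of_real abs_power2)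
    also have "\<dots> \<le> l2norm v * (?r * l2norm v)"
      by (intro mult_left_mono l2norm_conv_le_op_norm \<phi> l2norm_nonneg)
    also have "\<dots> = (sqrt ?r * l2norm v)\<^sup>2"
      using op_norm_nonneg[of "conv (adj f) f"] by (simp add: power2_eq_square algebra_simps)
    finally show "l2norm ?u \<le> sqrt ?r * l2norm v"
      by (rule power2_le_imp_le) (simp add: l2norm_nonneg op_norm_nonneg)
  qed (simp add: op_norm_nonneg)
  then have "(op_norm f)\<^sup>2 \<le> (sqrt ?r)\<^sup>2" by (intro power_mono) (auto simp: op_norm_nonneg)
  then show ?thesis by (simp add: op_norm_nonneg)
qed

lemma op_norm_adj_ge: "op_norm f \<le> op_norm (adj f)"
proof (cases "op_norm f = 0")
  case False
  have "op_norm f * op_norm f \<le> op_norm (adj f) * op_norm f"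
    using op_norm_square_le[of f] op_norm_conv[of "adj f" f] by (simp add: power2_eq_square)
  then show ?thesis using False op_norm_nonneg[of f] by simp
qed (simp add: op_norm_nonneg)

lemma op_norm_cstar:
  assumes "f \<in> G \<rightarrow>\<^sub>E UNIV"
  shows "op_norm (conv (adj f) f) = (op_norm f)\<^sup>2"
proof (rule antisym)
  have "op_norm (conv (adj f) f) \<le> op_norm (adj f) * op_norm f" by (rule op_norm_conv)
  also have "\<dots> \<le> op_norm f * op_norm f"
    using op_norm_adj_ge[of "adj f"] adj_adj[OF assms] by (intro mult_right_mono) (auto simp: op_norm_nonneg)
  finally show "op_norm (conv (adj f) f) \<le> (op_norm f)\<^sup>2" by (simp add: power2_eq_square)
qed (rule op_norm_square_le)

lemma entrywise_bounded_op_norm: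
  "entrywise_bounded_norm G (op_norm :: ('g \<Rightarrow> 'a::comm_unital_cstar_algebra) \<Rightarrow> real) (card G)"
  by standard
    (simp_all add: finite_G op_norm_add op_norm_scale norm_entry_le_op_norm
      op_norm_least[OF card_sum_in_bounds])

theorem cstar_algebra_conv:
  "cstar_algebra_on (G \<rightarrow>\<^sub>E (UNIV :: 'a::comm_unital_cstar_algebra set))
     (fun_add G) (fun_zero G) (fun_scale G) conv adj op_norm"
proof -
  interpret entrywise_bounded_norm G "op_norm :: ('g \<Rightarrow> 'a) \<Rightarrow> real" "card G"
    by (rule entrywise_bounded_op_norm)
  show ?thesis
    by standard
      (simp_all only: conv_closed conv_assoc conv_add_left conv_add_right conv_scale_left
        conv_scale_right adj_closed adj_adj adj_add adj_scale adj_conv nrm_nonneg nrm_eq_zero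
        op_norm_add op_norm_scale op_norm_conv op_norm_cstar mcomplete)
qed

end


section \<open>Hyper-C*-algebras of functions and their reindexing\<close>

lemma hyper_cstar_algebra_fun:
  fixes S :: "'s set"
    and mult :: "'i \<Rightarrow> ('s \<Rightarrow> 'a::comm_unital_cstar_algebra) \<Rightarrow> ('s \<Rightarrow> 'a) \<Rightarrow> 's \<Rightarrow> 'a"
  assumes "finite I"
    and norms: "\<And>i. i \<in> I \<Longrightarrow> \<exists>nrm C. entrywise_bounded_norm S nrm C \<and>
      cstar_algebra_on (S \<rightarrow>\<^sub>E UNIV) (fun_add S) (fun_zero S) (fun_scale S) (mult i) (invol i) nrm"
  shows "hyper_cstar_algebra (S \<rightarrow>\<^sub>E UNIV) (fun_add S) (fun_zero S) (fun_scale S) (fun_topology S)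
    I mult invol"
proof -
  interpret complete_tvs_on "S \<rightarrow>\<^sub>E (UNIV :: 'a set)" "fun_add S" "fun_zero S" "fun_scale S" "fun_topology S"
    by (rule complete_tvs_on_fun)
  show ?thesis
  proof
    fix i assume "i \<in> I"
    with norms obtain nrm C where b: "entrywise_bounded_norm S nrm C"
      and c: "cstar_algebra_on (S \<rightarrow>\<^sub>E UNIV) (fun_add S) (fun_zero S) (fun_scale S) (mult i) (invol i) nrm"
      by blast
    show "\<exists>nrm. cstar_algebra_on (S \<rightarrow>\<^sub>E UNIV) (fun_add S) (fun_zero S) (fun_scale S) (mult i) (invol i) nrm \<and>
        Metric_space.mtopology (S \<rightarrow>\<^sub>E UNIV) (norm_dist nrm) = fun_topology S"
      using c entrywise_bounded_norm.mtopology_eq[OF b] by blast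
  qed fact
qed

text \<open>C*-structures, topologies and norms on function spaces are carried along bijections of the index sets. In
  this way the products and involutions of hypermatrices acquire C*-norms from those of sections.\<close>

definition reindex :: "'t set \<Rightarrow> ('t \<Rightarrow> 's) \<Rightarrow> ('s \<Rightarrow> 'a) \<Rightarrow> 't \<Rightarrow> 'a" where
  "reindex T u f = (\<lambda>t\<in>T. f (u t))"

locale reindexing =
  fixes T :: "'t set" and S :: "'s set" and u :: "'t \<Rightarrow> 's"
  assumes bij: "bij_betw u T S"
begin

lemma u_in: "t \<in> T \<Longrightarrow> u t \<in> S"
  using bij by (auto simp: bij_betw_def)

lemma reindexing_inverse: "reindexing S T (inv_into T u)"
  by standard (rule bij_betw_inv_into[OF bij])

lemma reindex_closed: "reindex T u f \<in> T \<rightarrow>\<^sub>E UNIV"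
  by (simp add: reindex_def)

lemma reindex_inverse_reindex: "f \<in> S \<rightarrow>\<^sub>E UNIV \<Longrightarrow> reindex S (inv_into T u) (reindex T u f) = f"
  using bij
  by (auto simp: reindex_def fun_eq_iff PiE_def extensional_def bij_betw_def f_inv_into_f inv_into_into)

lemma reindex_reindex_inverse: "g \<in> T \<rightarrow>\<^sub>E UNIV \<Longrightarrow> reindex T u (reindex S (inv_into T u) g) = g"
  using bij by (auto simp: reindex_def fun_eq_iff PiE_def extensional_def bij_betw_def)

lemma bij_betw_reindex: "bij_betw (reindex T u) (S \<rightarrow>\<^sub>E UNIV) (T \<rightarrow>\<^sub>E UNIV)"
  by (intro bij_betw_byWitness[where f' = "reindex S (inv_into T u)"] ballI image_subsetI
      reindex_inverse_reindex reindex_reindex_inverse reindex_closed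
      reindexing.reindex_closed[OF reindexing_inverse])

lemma reindex_inject:
  "\<lbrakk>f \<in> S \<rightarrow>\<^sub>E UNIV; g \<in> S \<rightarrow>\<^sub>E UNIV\<rbrakk> \<Longrightarrow> reindex T u f = reindex T u g \<longleftrightarrow> f = g"
  by (metis reindex_inverse_reindex)

lemma reindex_add: "reindex T u (fun_add S f g) = fun_add T (reindex T u f) (reindex T u g)"
  by (auto simp: reindex_def fun_add_def fun_eq_iff u_in)

lemma reindex_scale: "reindex T u (fun_scale S c f) = fun_scale T c (reindex T u f)"
  by (auto simp: reindex_def fun_scale_def fun_eq_iff u_in)

lemma continuous_map_reindex: "continuous_map (fun_topology S) (fun_topology T) (reindex T u)"
  unfolding fun_topology_def[of T] continuous_map_componentwise
  by (auto simp: reindex_def fun_topology_def u_in intro: continuous_map_product_projection)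

lemma homeomorphic_map_reindex:
  "homeomorphic_map (fun_topology S) (fun_topology T)
     (reindex T u :: ('s \<Rightarrow> 'a::comm_unital_cstar_algebra) \<Rightarrow> 't \<Rightarrow> 'a)"
  unfolding homeomorphic_map_maps homeomorphic_maps_def
  by (intro exI[of _ "reindex S (inv_into T u)"] conjI continuous_map_reindex
      reindexing.continuous_map_reindex[OF reindexing_inverse])
    (auto simp: fun_topology_def reindex_inverse_reindex reindex_reindex_inverse)

lemma entrywise_bounded_norm_reindex:
  assumes "entrywise_bounded_norm T nrm C"
  shows "entrywise_bounded_norm S (\<lambda>f. nrm (reindex T u f)) C"
proof -
  interpret entrywise_bounded_norm T nrm C by fact
  show ?thesis
  proof
    show "finite S" using finite bij by (simp add: bij_betw_finite)
    fix f g :: "'s \<Rightarrow> 'a" and c s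
    show "nrm (reindex T u (fun_add S f g)) \<le> nrm (reindex T u f) + nrm (reindex T u g)"
      by (simp add: reindex_add triangle reindex_closed)
    show "nrm (reindex T u (fun_scale S c f)) = cmod c * nrm (reindex T u f)"
      by (simp add: reindex_scale scale reindex_closed)
    show "nrm (reindex T u f) \<le> C * (\<Sum>s\<in>S. norm (f s))"
      using upper[OF reindex_closed, of f] sum.reindex_bij_betw[OF bij, of "\<lambda>s. norm (f s)"]
      by (simp add: reindex_def)
    assume "s \<in> S"
    then obtain t where "t \<in> T" "s = u t" using bij by (auto simp: bij_betw_def)
    then show "norm (f s) \<le> nrm (reindex T u f)"
      using lower[OF reindex_closed, of t f] by (simp add: reindex_def)
  qed
qed

lemma cstar_algebra_reindex:
  fixes nrm :: "('t \<Rightarrow> 'a::comm_unital_cstar_algebra) \<Rightarrow> real"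
    and mult :: "('s \<Rightarrow> 'a) \<Rightarrow> ('s \<Rightarrow> 'a) \<Rightarrow> 's \<Rightarrow> 'a" and invol :: "('s \<Rightarrow> 'a) \<Rightarrow> 's \<Rightarrow> 'a"
  assumes bound: "entrywise_bounded_norm T nrm C"
    and cstar: "cstar_algebra_on (T \<rightarrow>\<^sub>E UNIV) (fun_add T) (fun_zero T) (fun_scale T) mult' invol' nrm"
    and mult_closed: "\<And>f g. mult f g \<in> S \<rightarrow>\<^sub>E UNIV"
    and inv_closed: "\<And>f. invol f \<in> S \<rightarrow>\<^sub>E UNIV"
    and mult: "\<And>f g. \<lbrakk>f \<in> S \<rightarrow>\<^sub>E UNIV; g \<in> S \<rightarrow>\<^sub>E UNIV\<rbrakk> \<Longrightarrow>
      reindex T u (mult f g) = mult' (reindex T u f) (reindex T u g)"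
    and invol: "\<And>f. f \<in> S \<rightarrow>\<^sub>E UNIV \<Longrightarrow> reindex T u (invol f) = invol' (reindex T u f)"
  shows "cstar_algebra_on (S \<rightarrow>\<^sub>E UNIV) (fun_add S) (fun_zero S) (fun_scale S) mult invol
    (\<lambda>f. nrm (reindex T u f))"
proof -
  interpret B: entrywise_bounded_norm S "\<lambda>f. nrm (reindex T u f)" C
    by (rule entrywise_bounded_norm_reindex[OF bound])
  interpret A: cstar_algebra_on "T \<rightarrow>\<^sub>E UNIV" "fun_add T" "fun_zero T" "fun_scale T" mult' invol' nrm
    by (rule cstar)
  note closed = mult_closed inv_closed B.add_closed B.scale_closed reindex_closed
  note transfer = reindex_add reindex_scale mult invol closed
  show ?thesis
  proof
    show "B.M.mcomplete" by (rule B.mcomplete)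
    show "mult f g \<in> B.V" "invol f \<in> B.V" for f g by (rule closed)+
    fix f g h c assume f: "f \<in> B.V"
    show "invol (invol f) = f" "invol (fun_scale S c f) = fun_scale S (cnj c) (invol f)"
      "nrm (reindex T u (mult (invol f) f)) = (nrm (reindex T u f))\<^sup>2"
      using f by (subst reindex_inject[symmetric] | simp only: transfer A.inv_inv A.inv_scale A.nrm_cstar)+
    show "0 \<le> nrm (reindex T u f)" "nrm (reindex T u f) = 0 \<longleftrightarrow> f = fun_zero S"
      "nrm (reindex T u (fun_scale S c f)) = cmod c * nrm (reindex T u f)"
      using f by (simp_all only: B.nrm_nonneg B.nrm_eq_zero B.scale)
    assume g: "g \<in> B.V"
    show "mult (fun_scale S c f) g = fun_scale S c (mult f g)"
      "mult f (fun_scale S c g) = fun_scale S c (mult f g)"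
      "invol (fun_add S f g) = fun_add S (invol f) (invol g)"
      "invol (mult f g) = mult (invol g) (invol f)"
      "nrm (reindex T u (mult f g)) \<le> nrm (reindex T u f) * nrm (reindex T u g)"
      using f g by (subst reindex_inject[symmetric] |
        simp only: transfer A.mult_scale_left A.mult_scale_right A.inv_add A.inv_mult A.nrm_mult)+
    show "nrm (reindex T u (fun_add S f g)) \<le> nrm (reindex T u f) + nrm (reindex T u g)"
      using f g by (rule B.triangle)
    assume h: "h \<in> B.V"
    show "mult (mult f g) h = mult f (mult g h)"
      "mult (fun_add S f g) h = fun_add S (mult f h) (mult g h)"
      "mult f (fun_add S g h) = fun_add S (mult f g) (mult f h)"
      using f g h by (subst reindex_inject[symmetric] |
        simp only: transfer A.mult_assoc A.mult_add_left A.mult_add_right)+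
  qed
qed

end

section \<open>The full-depth compositions on a product of pair groupoids\<close>

text \<open>Every axiom holds level by level: the levels in \<open>\<beta>\<close> form a discrete groupoid, the others a
  pair groupoid.\<close>

lemma finite_groupoid_full_depth:
  "finite_groupoid (pair_product n N) (fd_composable n \<beta>) (fd_comp n \<beta>) (fd_inv n \<beta>)"
  if "\<beta> \<subseteq> {1..n}"
proof -
  let ?X = "pair_product n N"
  have ext: "x = y" if "x \<in> ?X" "y \<in> ?X" "\<And>p. p \<in> {1..n} \<Longrightarrow> x p = y p" for x y
    using that unfolding pair_product_def by (rule PiE_ext)
  have comp_X: "fd_comp n \<beta> x y \<in> ?X" if "x \<in> ?X" "y \<in> ?X" for x y
    using that unfolding pair_product_def
    by (auto simp: fd_comp_def pair_comp_def PiE_iff mem_Times_iff)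
  have inv_X: "fd_inv n \<beta> x \<in> ?X" if "x \<in> ?X" for x
    using that unfolding pair_product_def
    by (auto simp: fd_inv_def pair_inv_def PiE_iff mem_Times_iff)
  have in_n: "p \<in> {1..n}" if "p \<in> \<beta>" for p using that \<open>\<beta> \<subseteq> {1..n}\<close> by blast
  note defs = fd_composable_def fd_comp_def fd_inv_def pair_comp_def pair_inv_def pair_composable_def
  show ?thesis
  proof
    show "finite ?X" unfolding pair_product_def by (intro finite_PiE) auto
    fix x y z assume x: "x \<in> ?X"
    show "fd_inv n \<beta> x \<in> ?X" by (rule inv_X[OF x])
    show "fd_inv n \<beta> (fd_inv n \<beta> x) = x"
      by (rule ext) (auto simp: inv_X x, auto simp: defs)
    show "fd_composable n \<beta> x (fd_inv n \<beta> x)"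
      using in_n by (auto simp: defs)
    assume y: "y \<in> ?X"
    show "fd_comp n \<beta> x y \<in> ?X" by (rule comp_X[OF x y])
    show "fd_composable n \<beta> (fd_inv n \<beta> x) (fd_comp n \<beta> x y)"
      using in_n by (auto simp: defs)
    show "fd_composable n \<beta> (fd_inv n \<beta> y) (fd_inv n \<beta> x)" if "fd_composable n \<beta> x y"
      using in_n that by (auto simp: defs)
    show "fd_inv n \<beta> (fd_comp n \<beta> x y) = fd_comp n \<beta> (fd_inv n \<beta> y) (fd_inv n \<beta> x)"
      if "fd_composable n \<beta> x y"
      using that by (intro ext inv_X comp_X x y) (auto simp: defs)
    show "fd_comp n \<beta> (fd_inv n \<beta> x) (fd_comp n \<beta> x y) = y" if "fd_composable n \<beta> x y"
      using that by (intro ext inv_X comp_X x y) (auto simp: defs prod_eq_iff)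
    assume z: "z \<in> ?X"
    show "fd_composable n \<beta> x y \<and> fd_composable n \<beta> (fd_comp n \<beta> x y) z \<longleftrightarrow>
        fd_composable n \<beta> y z \<and> fd_composable n \<beta> x (fd_comp n \<beta> y z)"
      using in_n by (auto simp: defs)
    show "fd_comp n \<beta> (fd_comp n \<beta> x y) z = fd_comp n \<beta> x (fd_comp n \<beta> y z)"
      by (intro ext comp_X x y z) (auto simp: defs)
  qed
qed

lemma cstar_algebra_sections:
  assumes "\<beta> \<subseteq> {1..n}"
  shows "\<exists>nrm C. entrywise_bounded_norm (pair_product n N) nrm C \<and>
    cstar_algebra_on (sections n N :: ((nat \<Rightarrow> nat \<times> nat) \<Rightarrow> 'a::comm_unital_cstar_algebra) set)
      (fun_add (pair_product n N)) (fun_zero (pair_product n N)) (fun_scale (pair_product n N))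
      (conv_mult n N \<beta>) (conv_star n N \<beta>) nrm"
proof -
  interpret finite_groupoid "pair_product n N" "fd_composable n \<beta>" "fd_comp n \<beta>" "fd_inv n \<beta>"
    by (rule finite_groupoid_full_depth[OF assms])
  have "conv_mult n N \<beta> = (conv :: (_ \<Rightarrow> 'a) \<Rightarrow> _)" "conv_star n N \<beta> = (adj :: (_ \<Rightarrow> 'a) \<Rightarrow> _)"
    by (simp_all add: fun_eq_iff conv_mult_def conv_def factorizations_def conv_star_def adj_def)
  then show ?thesis
    using entrywise_bounded_op_norm[where ?'a='a] cstar_algebra_conv[where ?'a='a]
    unfolding sections_def by metis
qed

section \<open>Hypermatrices as sections\<close>

definition entry_of :: "nat \<Rightarrow> (nat \<Rightarrow> nat \<times> nat) \<Rightarrow> (nat \<Rightarrow> nat) \<times> (nat \<Rightarrow> nat)" where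
  "entry_of n z = (\<lambda>k\<in>{1..n}. fst (z k), \<lambda>k\<in>{1..n}. snd (z k))"

lemma section_of_eq_reindex: "section_of n N = reindex (pair_product n N) (entry_of n)"
  by (simp add: fun_eq_iff section_of_def reindex_def entry_of_def)

lemma reindexing_entry_of: "reindexing (pair_product n N) (entries n N) (entry_of n)"
proof
  show "bij_betw (entry_of n) (pair_product n N) (entries n N)"
  proof (rule bij_betw_byWitness[where f' = "\<lambda>(i, j). \<lambda>k\<in>{1..n}. (i k, j k)"])
    show "\<forall>z\<in>pair_product n N. (\<lambda>(i, j). \<lambda>k\<in>{1..n}. (i k, j k)) (entry_of n z) = z"
      by (auto simp: entry_of_def pair_product_def PiE_def extensional_def fun_eq_iff)
    show "\<forall>e\<in>entries n N. entry_of n ((\<lambda>(i, j). \<lambda>k\<in>{1..n}. (i k, j k)) e) = e"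
      by (auto simp: entry_of_def entries_def multi_indices_def PiE_def extensional_def fun_eq_iff)
    show "entry_of n ` pair_product n N \<subseteq> entries n N"
      by (auto simp: entry_of_def entries_def multi_indices_def pair_product_def PiE_iff mem_Times_iff)
    show "(\<lambda>(i, j). \<lambda>k\<in>{1..n}. (i k, j k)) ` entries n N \<subseteq> pair_product n N"
      by (auto simp: entries_def multi_indices_def pair_product_def PiE_iff)
  qed
qed

text \<open>An intermediate multi-index \<open>m\<close> at the levels in \<open>\<gamma>\<close> splits \<open>z = (i, j)\<close> into the arrows from
  \<open>i\<close> to \<open>m\<close> and from \<open>m\<close> to \<open>j\<close> at these levels, both equal to \<open>z\<close> elsewhere. All
  factorizations of \<open>z\<close> arise in this way, exactly once.\<close>

lemma section_of_hyp_mult: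
  assumes \<gamma>: "\<gamma> \<subseteq> {1..n}"
  shows "section_of n N (hyp_mult n N \<gamma> x y) =
    conv_mult n N ({1..n} - \<gamma>) (section_of n N x) (section_of n N y)"
proof
  fix z
  interpret reindexing "pair_product n N" "entries n N" "entry_of n" by (rule reindexing_entry_of)
  let ?X = "pair_product n N" and ?\<beta> = "{1..n} - \<gamma>"
  show "section_of n N (hyp_mult n N \<gamma> x y) z =
    conv_mult n N ?\<beta> (section_of n N x) (section_of n N y) z"
  proof (cases "z \<in> ?X")
    case z: True
    define i where "i = fst (entry_of n z)"
    define j where "j = snd (entry_of n z)"
    define left where "left m = (\<lambda>k\<in>{1..n}. (fst (z k), if k \<in> \<gamma> then m k else snd (z k)))" for m :: "nat \<Rightarrow> nat"
    define right where "right m = (\<lambda>k\<in>{1..n}. (if k \<in> \<gamma> then m k else fst (z k), snd (z k)))" for m :: "nat \<Rightarrow> nat"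
    define M where "M = (\<Pi>\<^sub>E k\<in>\<gamma>. {1..N k})"
    define P where "P = {(a, b). a \<in> ?X \<and> b \<in> ?X \<and> fd_composable n ?\<beta> a b \<and> fd_comp n ?\<beta> a b = z}"
    have zN: "fst (z k) \<in> {1..N k}" "snd (z k) \<in> {1..N k}" if "k \<in> {1..n}" for k
      using z that by (auto simp: pair_product_def PiE_iff mem_Times_iff)
    have z_out: "z k = undefined" if "k \<notin> {1..n}" for k
      using z that by (auto simp: pair_product_def PiE_iff extensional_def)
    have "section_of n N (hyp_mult n N \<gamma> x y) z =
        (\<Sum>m\<in>M. x (i, replace_at n \<gamma> m j) * y (replace_at n \<gamma> m i, j))"
      using z u_in[OF z] by (simp add: section_of_eq_reindex reindex_def hyp_mult_def M_def i_def j_def case_prod_beta)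
    also have "\<dots> = (\<Sum>m\<in>M. x (entry_of n (left m)) * y (entry_of n (right m)))"
      by (intro sum.cong refl arg_cong2[of _ _ _ _ "(*)"] arg_cong[of _ _ x] arg_cong[of _ _ y])
        (auto simp: entry_of_def replace_at_def left_def right_def i_def j_def fun_eq_iff)
    also have "\<dots> = (\<Sum>(a, b)\<in>P. x (entry_of n a) * y (entry_of n b))"
    proof (rule sum.reindex_bij_witness[where i = "\<lambda>(a, b). \<lambda>k\<in>\<gamma>. snd (a k)" and j = "\<lambda>m. (left m, right m)"])
      fix m assume m: "m \<in> M"
      show "(\<lambda>(a, b). \<lambda>k\<in>\<gamma>. snd (a k)) (left m, right m) = m"
        using m \<gamma> by (auto simp: M_def left_def PiE_def extensional_def fun_eq_iff)
      have "left m \<in> ?X" "right m \<in> ?X"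
        using m zN by (auto simp: M_def left_def right_def pair_product_def PiE_iff)
      moreover have "fd_composable n ?\<beta> (left m) (right m)" "fd_comp n ?\<beta> (left m) (right m) = z"
        using z_out
        by (auto simp: fd_composable_def fd_comp_def pair_composable_def pair_comp_def left_def right_def fun_eq_iff)
      ultimately show "(left m, right m) \<in> P" by (simp add: P_def)
    next
      fix q assume "q \<in> P"
      then obtain a b where q: "q = (a, b)" and a: "a \<in> ?X" and b: "b \<in> ?X"
        and comp: "fd_composable n ?\<beta> a b" and z_eq: "z = fd_comp n ?\<beta> a b" by (auto simp: P_def)
      define m where "m = (\<lambda>k\<in>\<gamma>. snd (a k))"
      have "left m = a" "right m = b"
        using a b comp \<gamma> unfolding z_eq m_def
        by (auto simp: left_def right_def z_eq fd_composable_def fd_comp_def pair_composable_def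
            pair_comp_def pair_product_def PiE_def extensional_def fun_eq_iff prod_eq_iff)
      then show "(left ((\<lambda>(a, b). \<lambda>k\<in>\<gamma>. snd (a k)) q), right ((\<lambda>(a, b). \<lambda>k\<in>\<gamma>. snd (a k)) q)) = q"
        by (simp add: q m_def)
      show "(\<lambda>(a, b). \<lambda>k\<in>\<gamma>. snd (a k)) q \<in> M"
        using a \<gamma> by (auto simp: q M_def pair_product_def PiE_iff mem_Times_iff)
    qed auto
    also have "\<dots> = conv_mult n N ?\<beta> (section_of n N x) (section_of n N y) z"
      using z by (auto simp: conv_mult_def P_def section_of_eq_reindex reindex_def intro!: sum.cong)
    finally show ?thesis .
  qed (simp add: section_of_def conv_mult_def)
qed

lemma section_of_hyp_star:
  assumes \<gamma>: "\<gamma> \<subseteq> {1..n}"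
  shows "section_of n N (hyp_star n N \<gamma> x) = conv_star n N ({1..n} - \<gamma>) (section_of n N x)"
proof
  fix z
  interpret reindexing "pair_product n N" "entries n N" "entry_of n" by (rule reindexing_entry_of)
  interpret finite_groupoid "pair_product n N" "fd_composable n ({1..n} - \<gamma>)"
    "fd_comp n ({1..n} - \<gamma>)" "fd_inv n ({1..n} - \<gamma>)"
    by (rule finite_groupoid_full_depth) simp
  show "section_of n N (hyp_star n N \<gamma> x) z = conv_star n N ({1..n} - \<gamma>) (section_of n N x) z"
  proof (cases "z \<in> pair_product n N")
    case True
    have "entry_of n (fd_inv n ({1..n} - \<gamma>) z) =
        (replace_at n \<gamma> (snd (entry_of n z)) (fst (entry_of n z)),
         replace_at n \<gamma> (fst (entry_of n z)) (snd (entry_of n z)))"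
      using \<gamma> by (auto simp: entry_of_def fd_inv_def pair_inv_def replace_at_def fun_eq_iff)
    then show ?thesis
      using True u_in[OF True] inv_closed[OF True]
      by (simp add: section_of_eq_reindex reindex_def hyp_star_def conv_star_def case_prod_beta)
  qed (simp add: section_of_def conv_star_def)
qed

theorem theorem5p35:
  fixes n :: nat and N :: "nat \<Rightarrow> nat"
    and MX :: "((nat \<Rightarrow> nat) \<times> (nat \<Rightarrow> nat) \<Rightarrow> 'a::comm_unital_cstar_algebra) set"
    and \<Gamma> :: "((nat \<Rightarrow> nat \<times> nat) \<Rightarrow> 'a) set"
  defines "E \<equiv> entries n N" and "X \<equiv> pair_product n N"
    and "MX \<equiv> hypermatrices n N" and "\<Gamma> \<equiv> sections n N"
  shows
    "hyper_cstar_algebra MX (fun_add E) (fun_zero E) (fun_scale E) (fun_topology E)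
       (Pow {1..n}) (hyp_mult n N) (hyp_star n N) \<and>
     hyper_cstar_algebra \<Gamma> (fun_add X) (fun_zero X) (fun_scale X) (fun_topology X)
       (Pow {1..n}) (conv_mult n N) (conv_star n N) \<and>
     bij_betw (section_of n N) MX \<Gamma> \<and>
     homeomorphic_map (fun_topology E) (fun_topology X)
       (section_of n N :: _ \<Rightarrow> (nat \<Rightarrow> nat \<times> nat) \<Rightarrow> 'a) \<and>
     (\<forall>x\<in>MX. \<forall>y\<in>MX. section_of n N (fun_add E x y) = fun_add X (section_of n N x) (section_of n N y)) \<and>
     (\<forall>c. \<forall>x\<in>MX. section_of n N (fun_scale E c x) = fun_scale X c (section_of n N x)) \<and>
     bij_betw (\<lambda>\<gamma>. {1..n} - \<gamma>) (Pow {1..n}) (Pow {1..n}) \<and>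
     (\<forall>\<gamma>\<in>Pow {1..n}.
        (\<forall>x\<in>MX. \<forall>y\<in>MX. section_of n N (hyp_mult n N \<gamma> x y) =
           conv_mult n N ({1..n} - \<gamma>) (section_of n N x) (section_of n N y)) \<and>
        (\<forall>x\<in>MX. section_of n N (hyp_star n N \<gamma> x) =
           conv_star n N ({1..n} - \<gamma>) (section_of n N x)))"
proof -
  interpret reindexing X E "entry_of n" unfolding X_def E_def by (rule reindexing_entry_of)
  have MX: "MX = E \<rightarrow>\<^sub>E UNIV" by (simp add: MX_def hypermatrices_def E_def)
  have \<Gamma>: "\<Gamma> = X \<rightarrow>\<^sub>E UNIV" by (simp add: \<Gamma>_def sections_def X_def)
  have section_eq: "section_of n N = (reindex X (entry_of n) :: (_ \<Rightarrow> 'a) \<Rightarrow> _)"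
    by (simp add: section_of_eq_reindex X_def)
  have mult: "section_of n N (hyp_mult n N \<gamma> x y) =
      conv_mult n N ({1..n} - \<gamma>) (section_of n N x) (section_of n N y)"
    and star: "section_of n N (hyp_star n N \<gamma> x) = conv_star n N ({1..n} - \<gamma>) (section_of n N x)"
    if "\<gamma> \<in> Pow {1..n}" for \<gamma> and x y :: "_ \<Rightarrow> 'a"
    using that section_of_hyp_mult section_of_hyp_star by blast+
  have "hyper_cstar_algebra MX (fun_add E) (fun_zero E) (fun_scale E) (fun_topology E)
       (Pow {1..n}) (hyp_mult n N) (hyp_star n N)"
    unfolding MX
  proof (rule hyper_cstar_algebra_fun)
    fix \<gamma> assume \<gamma>: "\<gamma> \<in> Pow {1..n}"
    obtain nrm :: "_ \<Rightarrow> real" and C where bound: "entrywise_bounded_norm X nrm C"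
      and cstar: "cstar_algebra_on (X \<rightarrow>\<^sub>E (UNIV :: 'a set)) (fun_add X) (fun_zero X) (fun_scale X)
        (conv_mult n N ({1..n} - \<gamma>)) (conv_star n N ({1..n} - \<gamma>)) nrm"
      using cstar_algebra_sections[of "{1..n} - \<gamma>" n N, where ?'a='a] unfolding X_def sections_def by auto
    have "cstar_algebra_on (E \<rightarrow>\<^sub>E UNIV) (fun_add E) (fun_zero E) (fun_scale E)
        (hyp_mult n N \<gamma>) (hyp_star n N \<gamma>) (\<lambda>f. nrm (reindex X (entry_of n) f))"
      using bound cstar
      by (rule cstar_algebra_reindex)
        (use \<gamma> mult star in \<open>auto simp: section_eq E_def hyp_mult_def hyp_star_def\<close>)
    then show "\<exists>nrm C. entrywise_bounded_norm E nrm C \<and> cstar_algebra_on (E \<rightarrow>\<^sub>E (UNIV :: 'a set))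
        (fun_add E) (fun_zero E) (fun_scale E) (hyp_mult n N \<gamma>) (hyp_star n N \<gamma>) nrm"
      using entrywise_bounded_norm_reindex[OF bound] by blast
  qed simp
  moreover have "hyper_cstar_algebra \<Gamma> (fun_add X) (fun_zero X) (fun_scale X) (fun_topology X)
       (Pow {1..n}) (conv_mult n N) (conv_star n N)"
    unfolding \<Gamma>
    by (rule hyper_cstar_algebra_fun)
      (use cstar_algebra_sections[of _ n N, where ?'a='a] in \<open>auto simp: X_def sections_def\<close>)
  moreover have "bij_betw (section_of n N) MX \<Gamma>"
    unfolding section_eq MX \<Gamma> by (rule bij_betw_reindex)
  moreover have "bij_betw (\<lambda>\<gamma>. {1..n} - \<gamma>) (Pow {1..n}) (Pow {1..n})"
    by (rule bij_betw_byWitness[where f' = "\<lambda>\<gamma>. {1..n} - \<gamma>"]) auto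
  ultimately show ?thesis
    using mult star by (simp add: section_eq homeomorphic_map_reindex reindex_add reindex_scale)
qed

end
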